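(* Let $t$ be a positive integer and let $S$ be a Seidel matrix. Then (a) $\chi_S(x)=(x^2-4t-1)^{2t+1}$ if and only if $(4t+1)I-S^2=O$; (b) $\chi_S(x)=x(x^2-4t-1)^{2t}$ if and only if $(4t+1)I-S^2$ is switching equivalent to $J_{4t+1}$; (c) $\chi_S(x)=(x^2-1)(x^2-4t-1)^{2t-1}$ if and only if $(4t+1)I-S^2$ is switching equivalent to \[\begin{pmatrix} 2J_{2t} & O\\ O & 2J_{2t}\end{pmatrix};\] (d) $\chi_S(x)=(x\pm2)(x\mp1)^2(x^2-4t-1)^{2(t-1)}$ if and only if $(4t+1)I-S^2$ is switching equivalent to \[\begin{pmatrix} 3J_{t-1} & J & J & J\\ J & 3J_t & -J & -J\\ J & -J & 3J_t & -J\\ J & -J & -J & 3J_t\end{pmatrix}.\]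
   Context: A Seidel matrix is a square $\{0,\pm1\}$-matrix $S$ with zero diagonal, all off-diagonal entries nonzero, and $S=\pm S^\top$. $\chi_S(x)=\det(xI-S)$. $J_k$ is the $k\times k$ all-ones matrix; in block matrices, $J$ and $O$ denote all-ones and all-zeros blocks (not necessarily square) of sizes determined by the diagonal blocks. Two integer matrices $A,B$ of order $n$ are switching equivalent if $A=P^{-1}BP$ for some signed permutation matrix $P$. *)

theory Defs
  imports "Jordan_Normal_Form.Char_Poly"
begin

text \<open>Matrices have positive order. The library type also contains the \<open>0 \<times> 0\<close> matrix, which is
  excluded here: it would satisfy \<open>(4t + 1)I - S\<^sup>2 = O\<close> vacuously.
  Both symmetric and skew-symmetric matrices count as Seidel matrices.\<close>

definition seidel_mat :: "int mat \<Rightarrow> bool" where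
  "seidel_mat S \<longleftrightarrow>
     square_mat S \<and> 0 < dim_row S \<and>
     (\<forall>i < dim_row S. \<forall>j < dim_row S. S $$ (i, j) \<in> {0, 1, -1}) \<and>
     (\<forall>i < dim_row S. S $$ (i, i) = 0) \<and>
     (\<forall>i < dim_row S. \<forall>j < dim_row S. i \<noteq> j \<longrightarrow> S $$ (i, j) \<noteq> 0) \<and>
     (S = S\<^sup>T \<or> S = - S\<^sup>T)"

definition signed_permutation_mat :: "int mat \<Rightarrow> bool" where
  "signed_permutation_mat P \<longleftrightarrow>
     square_mat P \<and>
     (\<forall>i < dim_row P. \<forall>j < dim_row P. P $$ (i, j) \<in> {0, 1, -1}) \<and>
     (\<forall>i < dim_row P. \<exists>!j. j < dim_row P \<and> P $$ (i, j) \<noteq> 0) \<and>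
     (\<forall>j < dim_row P. \<exists>!i. i < dim_row P \<and> P $$ (i, j) \<noteq> 0)"

text \<open>\<open>similar_mat_wit A B Q P\<close> says that \<open>A\<close>, \<open>B\<close>, \<open>Q\<close>, \<open>P\<close> are square of the same order,
  \<open>Q\<close> is the two-sided inverse of \<open>P\<close>, and \<open>A = Q * B * P\<close>.\<close>

definition switching_equivalent :: "int mat \<Rightarrow> int mat \<Rightarrow> bool" where
  "switching_equivalent A B \<longleftrightarrow>
     (\<exists>P Q. signed_permutation_mat P \<and> similar_mat_wit A B Q P)"

definition all_ones :: "nat \<Rightarrow> nat \<Rightarrow> int mat" where
  "all_ones nr nc = mat nr nc (\<lambda>_. 1)"

definition block_mat_c :: "nat \<Rightarrow> int mat" where
  "block_mat_c t =
     four_block_mat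
       (2 \<cdot>\<^sub>m all_ones (2 * t) (2 * t)) (0\<^sub>m (2 * t) (2 * t))
       (0\<^sub>m (2 * t) (2 * t))           (2 \<cdot>\<^sub>m all_ones (2 * t) (2 * t))"

text \<open>The \<open>4 \<times> 4\<close> block matrix
  \<open>(3J, J, J, J; J, 3J, -J, -J; J, -J, 3J, -J; J, -J, -J, 3J)\<close> with diagonal blocks of orders
  \<open>t - 1, t, t, t\<close>, grouped as a \<open>2 \<times> 2\<close> block matrix of \<open>2 \<times> 2\<close> block matrices.
  For \<open>t = 1\<close> the first block row and column are empty.\<close>

definition block_mat_d :: "nat \<Rightarrow> int mat" where
  "block_mat_d t =
     four_block_mat
       (four_block_mat (3 \<cdot>\<^sub>m all_ones (t - 1) (t - 1)) (all_ones (t - 1) t)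
                       (all_ones t (t - 1))           (3 \<cdot>\<^sub>m all_ones t t))
       (four_block_mat (all_ones (t - 1) t)           (all_ones (t - 1) t)
                       (- all_ones t t)               (- all_ones t t))
       (four_block_mat (all_ones t (t - 1))           (- all_ones t t)
                       (all_ones t (t - 1))           (- all_ones t t))
       (four_block_mat (3 \<cdot>\<^sub>m all_ones t t)           (- all_ones t t)
                       (- all_ones t t)               (3 \<cdot>\<^sub>m all_ones t t))"

end

theory Submission
  imports Defs "Jordan_Normal_Form.Schur_Decomposition"
begin

text \<open>
  Write \<open>M = (4t + 1)I - S\<^sup>2\<close>. A symmetric integer matrix \<open>f(S)\<close> is zero as soon as \<open>f\<close> vanishes
  on the spectrum of \<open>S\<close>, since \<open>tr f(S)\<^sup>2 = 0\<close>. So the characteristic polynomial of \<open>S\<close> yields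
  polynomial identities for \<open>M\<close> which exhibit \<open>M\<close> as a positive multiple of a Gram matrix, with
  constant diagonal \<open>1\<close>, \<open>2\<close> or \<open>3\<close>. By Cauchy-Schwarz and the parity of \<open>(S\<^sup>2)\<^sub>i\<^sub>j\<close>, the entries
  off the diagonal take only a few values, and rows \<open>i\<close> and \<open>j\<close> agree up to sign when \<open>M\<^sub>i\<^sub>j\<close> has
  maximal modulus. This partitions the indices into classes, whose sizes and relative signs are
  forced by the traces and (in case (d)) by the rank-one matrix \<open>4tM - M\<^sup>2\<close>.

  Conversely, the block matrix determines the eigenvalues of \<open>S\<^sup>2\<close>. As \<open>tr S = 0\<close>, the few
  eigenvalues of \<open>S\<close> other than \<open>\<plusminus> sqrt (4t + 1)\<close> sum to an even multiple of \<open>sqrt (4t + 1) > 2\<close>.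
  Their moduli add up to at most \<open>4\<close>, so they sum to zero and \<open>\<plusminus> sqrt (4t + 1)\<close> have equal
  multiplicity.
\<close>

section \<open>Traces and triangularization\<close>

definition mat_trace :: "'a :: comm_monoid_add mat \<Rightarrow> 'a" where
  "mat_trace A = (\<Sum>i<dim_row A. A $$ (i, i))"

lemma mult_mat_entry:
  assumes "A \<in> carrier_mat n m" "B \<in> carrier_mat m k" "i < n" "j < k"
  shows "(A * B) $$ (i, j) = (\<Sum>l<m. A $$ (i, l) * B $$ (l, j))"
  using assms by (auto simp: scalar_prod_def atLeast0LessThan intro!: sum.cong)

lemma mat_trace_mult_commute:
  fixes A B :: "'a :: comm_semiring_0 mat"
  assumes "A \<in> carrier_mat n n" "B \<in> carrier_mat n n"
  shows "mat_trace (A * B) = mat_trace (B * A)"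
proof -
  have "mat_trace (A * B) = (\<Sum>i<n. \<Sum>l<n. A $$ (i, l) * B $$ (l, i))"
    using assms by (auto simp: mat_trace_def mult_mat_entry simp del: index_mult_mat(1))
  also have "\<dots> = (\<Sum>l<n. \<Sum>i<n. B $$ (l, i) * A $$ (i, l))"
    by (subst sum.swap) (simp add: mult.commute)
  also have "\<dots> = mat_trace (B * A)"
    using assms by (auto simp: mat_trace_def mult_mat_entry simp del: index_mult_mat(1))
  finally show ?thesis .
qed

lemma mat_trace_conj:
  fixes A P Q :: "'a :: comm_semiring_1 mat"
  assumes "A \<in> carrier_mat n n" "P \<in> carrier_mat n n" "Q \<in> carrier_mat n n" "P * Q = 1\<^sub>m n"
  shows "mat_trace (Q * A * P) = mat_trace A"
proof -
  have "mat_trace (Q * A * P) = mat_trace (Q * (A * P))"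
    using assms by (simp add: assoc_mult_mat[of _ n n _ n _ n])
  also have "\<dots> = mat_trace (A * P * Q)"
    using assms by (intro mat_trace_mult_commute[of _ n]) auto
  also have "A * P * Q = A"
    using assms by (simp add: assoc_mult_mat[of _ n n _ n _ n])
  finally show ?thesis .
qed

lemma mat_trace_square_symmetric:
  fixes A :: "int mat"
  assumes "A \<in> carrier_mat n n" "A\<^sup>T = A"
  shows "mat_trace (A * A) = (\<Sum>i<n. \<Sum>j<n. (A $$ (i, j))\<^sup>2)"
proof -
  have "A $$ (j, i) = A $$ (i, j)" if "i < n" "j < n" for i j
    using assms that by (metis carrier_matD index_transpose_mat(1))
  then show ?thesis
    using assms by (auto simp: mat_trace_def mult_mat_entry[of _ n n] power2_eq_square simp del: index_mult_mat(1)
        intro!: sum.cong)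
qed

lemma upper_triangular_mult:
  fixes A B :: "'a :: semiring_0 mat"
  assumes A: "A \<in> carrier_mat n n" "upper_triangular A" and B: "B \<in> carrier_mat n n" "upper_triangular B"
  shows "upper_triangular (A * B)"
    and "i < n \<Longrightarrow> (A * B) $$ (i, i) = A $$ (i, i) * B $$ (i, i)"
proof -
  have A0: "A $$ (i, j) = 0" if "j < i" "i < n" for i j
    using upper_triangularD[OF A(2)] that A(1) by auto
  have B0: "B $$ (i, j) = 0" if "j < i" "i < n" for i j
    using upper_triangularD[OF B(2)] that B(1) by auto
  show "upper_triangular (A * B)"
  proof (rule upper_triangularI)
    fix i j assume "j < i" "i < dim_row (A * B)"
    then have "(A * B) $$ (i, j) = (\<Sum>l<n. A $$ (i, l) * B $$ (l, j))"
      using A B by (intro mult_mat_entry[of A n n B n]) auto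
    also have "\<dots> = 0"
    proof (intro sum.neutral ballI)
      fix l assume "l \<in> {..<n}"
      then show "A $$ (i, l) * B $$ (l, j) = 0"
        using A0[of l i] B0[of j l] \<open>j < i\<close> \<open>i < dim_row (A * B)\<close> A
        by (cases "l < i") auto
    qed
    finally show "(A * B) $$ (i, j) = 0" .
  qed
  assume i: "i < n"
  then have "(A * B) $$ (i, i) = (\<Sum>l<n. A $$ (i, l) * B $$ (l, i))"
    using A B by (intro mult_mat_entry) auto
  also have "\<dots> = (\<Sum>l\<in>{i}. A $$ (i, l) * B $$ (l, i))"
  proof (rule sum.mono_neutral_right)
    show "\<forall>l\<in>{..<n} - {i}. A $$ (i, l) * B $$ (l, i) = 0"
    proof
      fix l assume "l \<in> {..<n} - {i}"
      then show "A $$ (i, l) * B $$ (l, i) = 0"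
        using A0[of l i] B0[of i l] i by (cases "l < i") auto
    qed
  qed (use i in auto)
  finally show "(A * B) $$ (i, i) = A $$ (i, i) * B $$ (i, i)" by simp
qed

section \<open>Matrices triangularized together with \<open>S\<close>, and their eigenvalues\<close>

locale triangularized =
  fixes n :: nat and S :: "int mat" and P Q :: "complex mat" and es :: "complex list"
  assumes S: "S \<in> carrier_mat n n"
    and P: "P \<in> carrier_mat n n" and Q: "Q \<in> carrier_mat n n"
    and PQ: "P * Q = 1\<^sub>m n" and QP: "Q * P = 1\<^sub>m n"
    and len: "length es = n"
    and char_poly_S: "char_poly (map_mat of_int S) = (\<Prod>e\<leftarrow>es. [:- e, 1:])"
    and triangular: "upper_triangular (Q * map_mat of_int S * P)"
    and diagonal: "diag_mat (Q * map_mat of_int S * P) = es"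

lemma triangularized_exists:
  assumes "S \<in> carrier_mat n n"
  shows "\<exists>P Q es. triangularized n S P Q es"
proof -
  let ?S = "map_mat of_int S :: complex mat"
  have S: "?S \<in> carrier_mat n n" using assms by simp
  obtain es where es: "char_poly ?S = (\<Prod>e\<leftarrow>es. [:- e, 1:])" "length es = n"
    using char_poly_factorized[OF S] by auto
  obtain B P Q where B: "schur_decomposition ?S es = (B, P, Q)"
    by (cases "schur_decomposition ?S es") auto
  from schur_decomposition[OF S es(1) B]
  have B: "similar_mat_wit ?S B P Q" "upper_triangular B" "diag_mat B = es" by auto
  have W: "similar_mat_wit B ?S Q P" using B(1) by (rule similar_mat_wit_sym)
  have "dim_row B = n" using similar_mat_witD2[OF S B(1)] by auto
  from similar_mat_witD[OF this[symmetric] W]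
  have "triangularized n S P Q es" using assms es B by unfold_locales auto
  then show ?thesis by blast
qed

context triangularized
begin

text \<open>Stands in for \<open>A = f(S)\<close>: the fixed pair \<open>P\<close>, \<open>Q\<close>
  triangularizes \<open>A\<close> as well, and \<open>f\<close> records which diagonal value goes
  with which eigenvalue of \<open>S\<close>. The relation is closed under products, differences and
  multiples, and it determines traces.\<close>

definition acts_as :: "int mat \<Rightarrow> (complex \<Rightarrow> complex) \<Rightarrow> bool" where
  "acts_as A f \<longleftrightarrow> A \<in> carrier_mat n n \<and> upper_triangular (Q * map_mat of_int A * P)
     \<and> (\<forall>i<n. (Q * map_mat of_int A * P) $$ (i, i) = f (es ! i))"

lemma acts_asD: "acts_as A f \<Longrightarrow> A \<in> carrier_mat n n"
  by (simp add: acts_as_def)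

lemma acts_as_S: "acts_as S (\<lambda>e. e)"
  using S P Q triangular diagonal by (auto simp: acts_as_def diag_mat_def)

lemma acts_as_one: "acts_as (1\<^sub>m n) (\<lambda>_. 1)"
  using P Q QP by (auto simp: acts_as_def of_int_hom.mat_hom_one)

lemma acts_as_smult:
  assumes "acts_as A f"
  shows "acts_as (c \<cdot>\<^sub>m A) (\<lambda>e. of_int c * f e)"
proof -
  have A: "A \<in> carrier_mat n n" using assms by (rule acts_asD)
  have "Q * map_mat of_int (c \<cdot>\<^sub>m A) * P = of_int c \<cdot>\<^sub>m (Q * map_mat of_int A * P)"
  proof -
    have "map_mat of_int (c \<cdot>\<^sub>m A) = (of_int c \<cdot>\<^sub>m map_mat of_int A :: complex mat)"
      using A by (intro eq_matI) auto
    then show ?thesis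
      using A P Q by (simp add: mult_smult_distrib[of _ n n _ n] mult_smult_assoc_mat[of _ n n _ n])
  qed
  then show ?thesis using assms A P Q
    by (auto simp: acts_as_def upper_triangular_def)
qed

lemma acts_as_mult:
  assumes "acts_as A f" "acts_as B g"
  shows "acts_as (A * B) (\<lambda>e. f e * g e)"
proof -
  let ?A = "map_mat of_int A :: complex mat" and ?B = "map_mat of_int B :: complex mat"
  have A: "A \<in> carrier_mat n n" and B: "B \<in> carrier_mat n n" using assms by (auto dest: acts_asD)
  have "Q * map_mat of_int (A * B) * P = Q * (?A * (P * Q) * ?B) * P"
    using A B by (simp add: PQ of_int_hom.mat_hom_mult)
  also have "\<dots> = (Q * ?A * P) * (Q * ?B * P)"
    using A B P Q by (simp add: assoc_mult_mat[of _ n n _ n _ n])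
  finally have *: "Q * map_mat of_int (A * B) * P = (Q * ?A * P) * (Q * ?B * P)" .
  show ?thesis
    using assms A B P Q upper_triangular_mult[of "Q * ?A * P" n "Q * ?B * P"]
    unfolding acts_as_def * by auto
qed

lemma acts_as_minus:
  assumes "acts_as A f" "acts_as B g"
  shows "acts_as (A - B) (\<lambda>e. f e - g e)"
proof -
  let ?A = "map_mat of_int A :: complex mat" and ?B = "map_mat of_int B :: complex mat"
  have A: "A \<in> carrier_mat n n" and B: "B \<in> carrier_mat n n" using assms by (auto dest: acts_asD)
  have "map_mat of_int (A - B) = ?A - ?B" using A B by (intro eq_matI) auto
  then have *: "Q * map_mat of_int (A - B) * P = (Q * ?A * P) - (Q * ?B * P)"
    using A B P Q by (simp add: mult_minus_distrib_mat[of _ n n _ n] minus_mult_distrib_mat[of _ n n _ _ n])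
  show ?thesis
    using assms A B P Q unfolding acts_as_def * by (auto simp: upper_triangular_def)
qed

lemma mat_trace_acts_as:
  assumes "acts_as A f"
  shows "of_int (mat_trace A) = (\<Sum>e\<leftarrow>es. f e)"
proof -
  let ?A = "map_mat of_int A :: complex mat"
  have A: "A \<in> carrier_mat n n" using assms by (rule acts_asD)
  have "of_int (mat_trace A) = mat_trace ?A" using A by (auto simp: mat_trace_def)
  also have "\<dots> = mat_trace (Q * ?A * P)"
    using A P Q PQ by (intro mat_trace_conj[symmetric]) auto
  also have "\<dots> = (\<Sum>i<n. f (es ! i))"
    using assms Q unfolding mat_trace_def by (auto simp: acts_as_def)
  also have "\<dots> = (\<Sum>e\<leftarrow>es. f e)"
    by (simp add: sum_list_sum_nth len atLeast0LessThan)
  finally show ?thesis .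
qed

text \<open>A matrix identity gives one matrix two descriptions, and comparing diagonals yields an
  equation for every eigenvalue of \<open>S\<close>. This is how the block matrices constrain the
  spectrum.\<close>

lemma acts_as_eq:
  assumes "acts_as A f" "acts_as A g" "e \<in> set es"
  shows "f e = g e"
  using assms by (auto simp: acts_as_def in_set_conv_nth len)

text \<open>A zero diagonal in triangular form makes \<open>A\<close> nilpotent only. Symmetry turns
  \<open>tr A^2 = 0\<close> into a vanishing sum of squares of integers.\<close>

lemma symmetric_acts_as_zero:
  assumes "acts_as A f" "A\<^sup>T = A" "\<And>e. e \<in> set es \<Longrightarrow> f e = 0"
  shows "A = 0\<^sub>m n n"
proof -
  have A: "A \<in> carrier_mat n n" using assms(1) by (rule acts_asD)
  have "of_int (mat_trace (A * A)) = (\<Sum>e\<leftarrow>es. f e * f e)"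
    using assms(1) by (intro mat_trace_acts_as acts_as_mult)
  also have "\<dots> = (\<Sum>e\<leftarrow>es. 0)" using assms(3) by (intro arg_cong[where f = sum_list] map_cong) auto
  finally have "mat_trace (A * A) = 0" by simp
  then have "(\<Sum>i<n. \<Sum>j<n. (A $$ (i, j))\<^sup>2) = 0"
    using mat_trace_square_symmetric[OF A assms(2)] by simp
  then have "\<forall>i<n. \<forall>j<n. A $$ (i, j) = 0"
    by (subst (asm) sum_nonneg_eq_0_iff; (simp add: sum_nonneg)?)
       (auto simp: sum_nonneg_eq_0_iff)
  then show ?thesis using A by (intro eq_matI) auto
qed

lemma symmetric_acts_as_eqI:
  assumes "acts_as A f" "acts_as B g" "A\<^sup>T = A" "B\<^sup>T = B" "\<And>e. e \<in> set es \<Longrightarrow> f e = g e"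
  shows "A = B"
proof -
  have A: "A \<in> carrier_mat n n" and B: "B \<in> carrier_mat n n" using assms by (auto dest: acts_asD)
  have "(A - B)\<^sup>T = A - B"
    using A B transpose_minus[of A n n B] assms(3,4) by simp
  then have *: "A - B = 0\<^sub>m n n"
    using assms by (intro symmetric_acts_as_zero[OF acts_as_minus[OF assms(1,2)]]) auto
  have "A $$ (i, j) = B $$ (i, j)" if "i < n" "j < n" for i j
    using arg_cong[OF *, of "\<lambda>C. C $$ (i, j)"] A B that by simp
  then show ?thesis using A B by (intro eq_matI) auto
qed

text \<open>Integer polynomials embed into complex ones, where a product of monic linear factors
  determines its multiset of roots. Questions about \<open>char_poly S\<close> thus become questions
  about \<open>es\<close>.\<close>

lemma char_poly_eq_iff:
  assumes "map_poly of_int g = (\<Prod>e\<leftarrow>fs. [:- e, 1:])"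
  shows "char_poly S = g \<longleftrightarrow> mset es = mset fs"
proof -
  have proots: "proots (\<Prod>e\<leftarrow>xs. [:- e, 1:]) = mset xs" for xs :: "complex list"
  proof (induction xs)
    case (Cons a xs)
    have "(\<Prod>e\<leftarrow>xs. [:- e, 1:]) \<noteq> 0" by auto
    then show ?case using Cons by (simp add: proots_mult del: mult_pCons_left)
  qed simp
  have "char_poly S = g \<longleftrightarrow> map_poly of_int (char_poly S) = (map_poly of_int g :: complex poly)"
    by (metis of_int_poly_hom.injectivity)
  also have "\<dots> \<longleftrightarrow> (\<Prod>e\<leftarrow>es. [:- e, 1:]) = (\<Prod>e\<leftarrow>fs. [:- e, 1:])"
    using char_poly_S[unfolded of_int_hom.char_poly_hom[OF S]] assms by simp
  also have "\<dots> \<longleftrightarrow> mset es = mset fs"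
    by (metis proots mset_map prod_mset_prod_list)
  finally show ?thesis .
qed

end

section \<open>Switching equivalence from a matching of index classes\<close>

text \<open>Fibers over the same label have equal size and so admit bijections; fibers over distinct
  labels are disjoint, so these bijections glue.\<close>

lemma bij_betw_matching_fibers:
  assumes fin: "finite A" "finite B"
    and card: "\<And>k. card {a \<in> A. f a = k} = card {b \<in> B. g b = k}"
  obtains \<sigma> where "bij_betw \<sigma> A B" "\<And>a. a \<in> A \<Longrightarrow> g (\<sigma> a) = f a"
proof -
  have "\<exists>h. bij_betw h {a \<in> A. f a = k} {b \<in> B. g b = k}" for k
    using fin card by (intro finite_same_card_bij) auto
  then obtain h where h: "\<And>k. bij_betw (h k) {a \<in> A. f a = k} {b \<in> B. g b = k}" by metis
  define \<sigma> where "\<sigma> a = h (f a) a" for a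
  have im: "\<sigma> a \<in> B \<and> g (\<sigma> a) = f a" if "a \<in> A" for a
    using bij_betw_apply[OF h[of "f a"], of a] that by (auto simp: \<sigma>_def)
  have "bij_betw \<sigma> A B"
  proof (rule bij_betw_imageI)
    show "inj_on \<sigma> A"
    proof (rule inj_onI)
      fix a a' assume *: "a \<in> A" "a' \<in> A" "\<sigma> a = \<sigma> a'"
      then have "f a = f a'" using im by metis
      with * show "a = a'"
        using bij_betw_imp_inj_on[OF h[of "f a"]] by (auto simp: \<sigma>_def inj_on_def)
    qed
    show "\<sigma> ` A = B"
    proof
      show "\<sigma> ` A \<subseteq> B" using im by auto
      show "B \<subseteq> \<sigma> ` A"
      proof
        fix b assume "b \<in> B"
        then have "b \<in> h (g b) ` {a \<in> A. f a = g b}"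
          using bij_betw_imp_surj_on[OF h[of "g b"]] by auto
        then show "b \<in> \<sigma> ` A" by (force simp: \<sigma>_def)
      qed
    qed
  qed
  with im that show ?thesis by blast
qed

text \<open>The signed permutation matrix \<open>P\<close> has entry \<open>\<delta> i\<close> at
  position \<open>(\<sigma> i, i)\<close>, and its transpose is its inverse.\<close>

lemma switching_equivalentI:
  assumes A: "A \<in> carrier_mat n n" and B: "B \<in> carrier_mat n n"
    and \<sigma>: "bij_betw \<sigma> {..<n} {..<n}"
    and \<delta>: "\<And>i. i < n \<Longrightarrow> \<delta> i \<in> {1, -1 :: int}"
    and entries: "\<And>i j. i < n \<Longrightarrow> j < n \<Longrightarrow> A $$ (i, j) = \<delta> i * \<delta> j * B $$ (\<sigma> i, \<sigma> j)"
  shows "switching_equivalent A B"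
proof -
  define P where "P = mat n n (\<lambda>(k, i). if k = \<sigma> i then \<delta> i else 0)"
  have P: "P \<in> carrier_mat n n" by (simp add: P_def)
  have \<sigma>_less: "\<sigma> i < n" if "i < n" for i
    using bij_betwE[OF \<sigma>] that by auto
  have \<sigma>_eq: "\<sigma> i = \<sigma> j \<longleftrightarrow> i = j" if "i < n" "j < n" for i j
    using bij_betw_imp_inj_on[OF \<sigma>] that by (auto simp: inj_on_def)
  have \<sigma>_ex: "\<exists>!i. i < n \<and> k = \<sigma> i" if "k < n" for k
    using bij_betw_imp_surj_on[OF \<sigma>] that \<sigma>_eq by (metis imageE lessThan_iff)
  have \<delta>_sq: "\<delta> i * \<delta> i = 1" if "i < n" for i using \<delta>[OF that] by auto
  have \<delta>_nz: "\<delta> i \<noteq> 0" if "i < n" for i using \<delta>[OF that] by auto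
  have "signed_permutation_mat P"
    unfolding signed_permutation_mat_def
  proof (intro conjI allI impI)
    show "square_mat P" by (simp add: P_def)
    fix i assume i: "i < dim_row P"
    then have i: "i < n" by (simp add: P_def)
    have "j < dim_row P \<and> P $$ (i, j) \<noteq> 0 \<longleftrightarrow> j < n \<and> i = \<sigma> j" for j
      using i \<delta>_nz by (auto simp: P_def split: if_splits)
    then show "\<exists>!j. j < dim_row P \<and> P $$ (i, j) \<noteq> 0" using \<sigma>_ex[OF i] by simp
    have "j < dim_row P \<and> P $$ (j, i) \<noteq> 0 \<longleftrightarrow> j = \<sigma> i" for j
      using i \<delta>_nz \<sigma>_less by (auto simp: P_def split: if_splits)
    then show "\<exists>!j. j < dim_row P \<and> P $$ (j, i) \<noteq> 0" by simp
    fix j assume "j < dim_row P"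
    then show "P $$ (i, j) \<in> {0, 1, - 1}" using i \<delta>[of j] by (auto simp: P_def)
  qed
  moreover have "similar_mat_wit A B P\<^sup>T P"
  proof (rule similar_mat_witI[of _ _ n])
    show "P\<^sup>T * P = 1\<^sub>m n"
    proof (rule eq_matI)
      fix i j assume ij: "i < dim_row (1\<^sub>m n)" "j < dim_col (1\<^sub>m n)"
      then have "(P\<^sup>T * P) $$ (i, j) = (\<Sum>l<n. P\<^sup>T $$ (i, l) * P $$ (l, j))"
        using P by (intro mult_mat_entry) auto
      also have "\<dots> = (\<Sum>l<n. if l = \<sigma> i then \<delta> i * P $$ (l, j) else 0)"
        using ij by (intro sum.cong) (auto simp: P_def)
      also have "\<dots> = \<delta> i * P $$ (\<sigma> i, j)" using ij \<sigma>_less by simp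
      also have "\<dots> = 1\<^sub>m n $$ (i, j)" using ij \<sigma>_less \<sigma>_eq \<delta>_sq by (auto simp: P_def)
      finally show "(P\<^sup>T * P) $$ (i, j) = 1\<^sub>m n $$ (i, j)" .
    qed (use P in auto)
    show "P * P\<^sup>T = 1\<^sub>m n"
    proof (rule eq_matI)
      fix k l assume "k < dim_row (1\<^sub>m n :: int mat)" "l < dim_col (1\<^sub>m n :: int mat)"
      then have kl: "k < n" "l < n" by auto
      obtain i where i: "i < n" "k = \<sigma> i" using \<sigma>_ex[OF kl(1)] by auto
      have "(P * P\<^sup>T) $$ (k, l) = (\<Sum>j<n. P $$ (k, j) * P\<^sup>T $$ (j, l))"
        using P kl by (intro mult_mat_entry) auto
      also have "\<dots> = (\<Sum>j<n. if j = i then (if l = k then 1 else 0) else 0)"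
        using i kl \<sigma>_eq \<delta>_sq by (intro sum.cong) (auto simp: P_def)
      also have "\<dots> = 1\<^sub>m n $$ (k, l)" using i kl by auto
      finally show "(P * P\<^sup>T) $$ (k, l) = 1\<^sub>m n $$ (k, l)" .
    qed (use P in auto)
    show "A = P\<^sup>T * B * P"
    proof (rule eq_matI)
      fix i j assume "i < dim_row (P\<^sup>T * B * P)" "j < dim_col (P\<^sup>T * B * P)"
      then have ij: "i < n" "j < n" using P by auto
      have "(P\<^sup>T * B) $$ (i, l) = \<delta> i * B $$ (\<sigma> i, l)" if "l < n" for l
      proof -
        have "(P\<^sup>T * B) $$ (i, l) = (\<Sum>k<n. P\<^sup>T $$ (i, k) * B $$ (k, l))"
          using P B ij that by (intro mult_mat_entry) auto
        also have "\<dots> = (\<Sum>k<n. if k = \<sigma> i then \<delta> i * B $$ (k, l) else 0)"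
          using ij by (intro sum.cong) (auto simp: P_def)
        finally show ?thesis using \<sigma>_less[OF ij(1)] by simp
      qed
      note row = this
      have "(P\<^sup>T * B * P) $$ (i, j) = (\<Sum>l<n. (P\<^sup>T * B) $$ (i, l) * P $$ (l, j))"
        using P B ij by (intro mult_mat_entry) auto
      also have "\<dots> = (\<Sum>l<n. if l = \<sigma> j then \<delta> i * B $$ (\<sigma> i, l) * \<delta> j else 0)"
        using ij row by (intro sum.cong) (auto simp: P_def)
      also have "\<dots> = A $$ (i, j)" using \<sigma>_less[OF ij(2)] entries[OF ij] by (simp add: mult.commute mult.left_commute)
      finally show "A $$ (i, j) = (P\<^sup>T * B * P) $$ (i, j)" by simp
    qed (use A P in auto)
  qed (use A B P in auto)
  ultimately show ?thesis unfolding switching_equivalent_def by blast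
qed

text \<open>The form in which (b), (c) and (d) are reached: entries depend on class labels through a
  common table \<open>\<beta>\<close>, so counting the classes suffices.\<close>

lemma switching_equivalent_fibersI:
  fixes f g :: "nat \<Rightarrow> 'k" and \<beta> :: "'k \<Rightarrow> 'k \<Rightarrow> int"
  assumes A: "A \<in> carrier_mat n n" and B: "B \<in> carrier_mat n n"
    and card: "\<And>k. card {i \<in> {..<n}. f i = k} = card {i \<in> {..<n}. g i = k}"
    and \<delta>: "\<And>i. i < n \<Longrightarrow> \<delta> i \<in> {1, -1 :: int}"
    and A_entries: "\<And>i j. i < n \<Longrightarrow> j < n \<Longrightarrow> A $$ (i, j) = \<delta> i * \<delta> j * \<beta> (f i) (f j)"
    and B_entries: "\<And>i j. i < n \<Longrightarrow> j < n \<Longrightarrow> B $$ (i, j) = \<beta> (g i) (g j)"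
  shows "switching_equivalent A B"
proof -
  obtain \<sigma> where \<sigma>: "bij_betw \<sigma> {..<n} {..<n}" "\<And>i. i < n \<Longrightarrow> g (\<sigma> i) = f i"
    using bij_betw_matching_fibers[OF finite_lessThan finite_lessThan card] by auto
  show ?thesis
    using bij_betwE[OF \<sigma>(1)] \<sigma>(2) A_entries B_entries
    by (intro switching_equivalentI[OF A B \<sigma>(1) \<delta>]) auto
qed

section \<open>Integral Gram matrices of small rank\<close>

text \<open>Expands the squared distance between the vectors \<open>w i\<close> and
  \<open>\<epsilon> * w j\<close>, where \<open>\<epsilon>\<close> is \<open>1\<close> or
  \<open>-1\<close>. The factor \<open>c\<close> is there because only a multiple of
  \<open>g\<close> is a Gram matrix of integer vectors.\<close>

lemma gram_difference:
  fixes g w :: "nat \<Rightarrow> nat \<Rightarrow> int"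
  assumes gram: "\<forall>i<n. \<forall>j<n. c * g i j = (\<Sum>k<N. w i k * w j k)"
    and "i < n" "j < n" "\<epsilon> * \<epsilon> = 1"
  shows "c * (g i i + g j j - 2 * \<epsilon> * g i j) = (\<Sum>k<N. (w i k - \<epsilon> * w j k)\<^sup>2)"
proof -
  have "(w i k - \<epsilon> * w j k)\<^sup>2 = w i k * w i k + w j k * w j k - 2 * \<epsilon> * (w i k * w j k)" for k
  proof -
    have "(w i k - \<epsilon> * w j k)\<^sup>2 = w i k * w i k + (\<epsilon> * \<epsilon>) * (w j k * w j k) - 2 * \<epsilon> * (w i k * w j k)"
      by (simp add: power2_eq_square algebra_simps)
    then show ?thesis using assms(4) by simp
  qed
  then have "(\<Sum>k<N. (w i k - \<epsilon> * w j k)\<^sup>2) = c * g i i + c * g j j - 2 * \<epsilon> * (c * g i j)"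
    using assms by (simp add: sum.distrib sum_subtractf sum_distrib_left)
  then show ?thesis by (simp add: algebra_simps)
qed

text \<open>Cauchy-Schwarz in the form used below: the two signs of \<open>\<epsilon>\<close>
  together bound \<open>2 * \<bar>g i j\<bar>\<close> by \<open>g i i + g j j\<close>.\<close>

lemma gram_nonneg:
  fixes g w :: "nat \<Rightarrow> nat \<Rightarrow> int"
  assumes "\<forall>i<n. \<forall>j<n. c * g i j = (\<Sum>k<N. w i k * w j k)"
    and "0 < c" "i < n" "j < n" "\<epsilon> * \<epsilon> = 1"
  shows "0 \<le> g i i + g j j - 2 * \<epsilon> * g i j"
proof -
  have "0 \<le> c * (g i i + g j j - 2 * \<epsilon> * g i j)"
    unfolding gram_difference[OF assms(1,3,4,5)] by (intro sum_nonneg) simp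
  then show ?thesis using assms(2) by (simp add: zero_le_mult_iff)
qed

text \<open>The equality case of the preceding bound: the squared distance is zero.\<close>

lemma gram_row_eq:
  fixes g w :: "nat \<Rightarrow> nat \<Rightarrow> int"
  assumes "\<forall>i<n. \<forall>j<n. c * g i j = (\<Sum>k<N. w i k * w j k)"
    and "i < n" "j < n" "\<epsilon> * \<epsilon> = 1" "g i i + g j j = 2 * \<epsilon> * g i j" "k < N"
  shows "w i k = \<epsilon> * w j k"
proof -
  have "(\<Sum>k<N. (w i k - \<epsilon> * w j k)\<^sup>2) = 0"
    using gram_difference[OF assms(1-4)] assms(5) by simp
  then show ?thesis using assms(6) by (simp add: sum_nonneg_eq_0_iff)
qed

text \<open>Cauchy-Schwarz and parity leave only the entries \<open>1\<close> and \<open>-1\<close>.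
  These are extremal, so all rows agree up to sign, and column 0 supplies the signs.\<close>

lemma rank_one_gram_signs:
  fixes m :: "nat \<Rightarrow> nat \<Rightarrow> int"
  assumes gram: "\<forall>i<n. \<forall>j<n. c * m i j = (\<Sum>k<n. m i k * m j k)"
    and "0 < c"
    and diag: "\<And>i. i < n \<Longrightarrow> m i i = 1"
    and odd: "\<And>i j. i < n \<Longrightarrow> j < n \<Longrightarrow> odd (m i j)"
  obtains \<delta> where "\<And>i. i < n \<Longrightarrow> \<delta> i \<in> {1, -1}" "\<And>i j. i < n \<Longrightarrow> j < n \<Longrightarrow> m i j = \<delta> i * \<delta> j"
proof -
  have pm: "m i j \<in> {1, -1}" if "i < n" "j < n" for i j
  proof -
    have "\<bar>m i j\<bar> \<le> 1"
      using gram_nonneg[OF gram \<open>0 < c\<close> that, where \<epsilon> = 1] gram_nonneg[OF gram \<open>0 < c\<close> that, where \<epsilon> = "-1"] diag that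
      by auto
    moreover have "m i j \<noteq> 0" using odd[OF that] by auto
    ultimately show ?thesis by auto
  qed
  have "m i j = m i 0 * m j 0" if ij: "i < n" "j < n" for i j
  proof -
    have n: "0 < n" using ij by auto
    have "m 0 k = m 0 l * m l k" if "k < n" "l < n" for k l
      using pm[OF n that(2)] diag that n by (intro gram_row_eq[OF gram]) auto
    \<comment> \<open>The last two instances have \<open>m 0 0 = 1\<close> on the left, which gives
      \<open>m 0 j = m j 0\<close> and \<open>m 0 i = m i 0\<close>.\<close>
    from this[OF ij(2,1)] this[OF n ij(2)] this[OF n ij(1)] 
    show ?thesis using pm[OF n ij(1)] pm[OF n ij(2)] diag[OF n] by auto
  qed
  moreover have "m i 0 \<in> {1, -1}" if "i < n" for i using pm that by auto
  ultimately show ?thesis using that[of "\<lambda>i. m i 0"] by blast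
qed

text \<open>Nonzero entries are \<open>2\<close> or \<open>-2\<close>, hence extremal, so the
  supports of two rows are equal or disjoint. A row has squared norm \<open>8t\<close> made of
  fours, so each support has \<open>2t\<close> elements and exactly two of them fill the
  \<open>4t\<close> indices.\<close>

lemma rank_two_gram_signs:
  fixes m :: "nat \<Rightarrow> nat \<Rightarrow> int"
  assumes gram: "\<forall>i<n. \<forall>j<n. int n * m i j = (\<Sum>k<n. m i k * m j k)"
    and n: "n = 4 * t" "0 < t"
    and sym: "\<And>i j. i < n \<Longrightarrow> j < n \<Longrightarrow> m i j = m j i"
    and diag: "\<And>i. i < n \<Longrightarrow> m i i = 2"
    and even: "\<And>i j. i < n \<Longrightarrow> j < n \<Longrightarrow> even (m i j)"
  obtains \<delta> :: "nat \<Rightarrow> int" and f :: "nat \<Rightarrow> bool"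
  where "\<And>i. i < n \<Longrightarrow> \<delta> i \<in> {1, -1}" "card {i \<in> {..<n}. f i} = 2 * t"
    "\<And>i j. i < n \<Longrightarrow> j < n \<Longrightarrow> m i j = \<delta> i * \<delta> j * (if f i = f j then 2 else 0)"
proof -
  have pos: "0 < int n" using n by simp
  have vals: "m i j \<in> {2, 0, -2}" if "i < n" "j < n" for i j
  proof -
    have "\<bar>m i j\<bar> \<le> 2"
      using gram_nonneg[OF gram pos that, where \<epsilon> = 1] gram_nonneg[OF gram pos that, where \<epsilon> = "-1"] diag that
      by auto
    moreover have "even (m i j)" using even that by simp
    then obtain b where "m i j = 2 * b" by auto
    ultimately show ?thesis by auto
  qed
  have row: "2 * m i k = m i j * m j k" if ij: "i < n" "j < n" and k: "k < n" and nz: "m i j \<noteq> 0" for i j k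
  proof -
    obtain \<epsilon> where \<epsilon>: "m i j = 2 * \<epsilon>" "\<epsilon> \<in> {1, -1}"
      using vals[OF ij] nz by (auto intro: that[of 1] that[of "-1"])
    have "m i k = \<epsilon> * m j k"
      using \<epsilon> ij k diag by (intro gram_row_eq[OF gram]) auto
    then show ?thesis using \<epsilon> by simp
  qed
  define cl where "cl i = {k \<in> {..<n}. m i k \<noteq> 0}" for i
  have card_cl: "card (cl i) = 2 * t" if "i < n" for i
  proof -
    have "8 * int t = (\<Sum>k<n. m i k * m i k)" using gram[rule_format, OF that that] diag[OF that] n by simp
    also have "\<dots> = (\<Sum>k\<in>cl i. 4)"
      unfolding cl_def sum.inter_filter[OF finite_lessThan] using vals[OF that] by (intro sum.cong) fastforce+
    finally show ?thesis by simp
  qed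
  have 0: "0 < n" using n by simp
  have "card (cl 0) \<noteq> card {..<n}" unfolding card_cl[OF 0] using n by simp
  then have "cl 0 \<noteq> {..<n}" by metis
  then obtain p where p: "p < n" "m 0 p = 0" by (auto simp: cl_def)
  have "cl 0 \<inter> cl p = {}"
  proof (rule ccontr)
    assume "cl 0 \<inter> cl p \<noteq> {}"
    then obtain k where "k < n" "m 0 k \<noteq> 0" "m p k \<noteq> 0" by (auto simp: cl_def)
    then show False using row[of 0 k p] sym[of k p] p 0 by simp
  qed
  moreover have fin: "finite (cl i)" for i by (simp add: cl_def)
  ultimately have "card (cl 0 \<union> cl p) = card {..<n}"
    using card_cl 0 p n by (subst card_Un_disjoint) auto
  then have "cl 0 \<union> cl p = {..<n}" by (intro card_subset_eq) (auto simp: cl_def)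
  then have cover: "m 0 i \<noteq> 0 \<or> m p i \<noteq> 0" if "i < n" for i using that by (auto simp: cl_def)
  define f where "f i \<longleftrightarrow> m 0 i \<noteq> 0" for i
  \<comment> \<open>The sign of an index relative to its class representative, which is
    \<open>0\<close> or \<open>p\<close>.\<close>
  define \<delta> where "\<delta> i = sgn (if f i then m 0 i else m p i)" for i
  show thesis
  proof (rule that)
    show "\<delta> i \<in> {1, -1}" if "i < n" for i
      using cover[OF that] by (auto simp: \<delta>_def f_def sgn_if)
    show "card {i \<in> {..<n}. f i} = 2 * t"
      using card_cl[OF 0] by (simp add: cl_def f_def)
    show "m i j = \<delta> i * \<delta> j * (if f i = f j then 2 else 0)" if ij: "i < n" "j < n" for i j
    proof -
      define r where "r = (if f i then 0 else p)"
      have r: "r < n" "m r i \<noteq> 0" using cover[OF ij(1)] p 0 by (auto simp: r_def f_def)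
      have A: "2 * m r j = m r i * m i j" using row[OF r(1) ij r(2)] .
      show ?thesis
      proof (cases "f i = f j")
        case True
        then have "m r j \<noteq> 0" using cover[OF ij(2)] by (auto simp: r_def f_def)
        moreover have "\<delta> i = sgn (m r i)" "\<delta> j = sgn (m r j)" using True by (auto simp: \<delta>_def r_def)
        ultimately show ?thesis using A True vals[OF r(1) ij(1)] vals[OF r(1) ij(2)] r(2) by auto
      next
        case False
        have "m r j = 0"
        proof (cases "f i")
          case True then show ?thesis using False by (simp add: r_def f_def)
        next
          case nf: False
          then have "m 0 j \<noteq> 0" using False by (simp add: f_def)
          then have "2 * m 0 p = m 0 j * m j p" using row[OF 0 ij(2) p(1)] by simp
          then have "m j p = 0" using p \<open>m 0 j \<noteq> 0\<close> by simp
          then show ?thesis using nf sym[OF ij(2) p(1)] by (simp add: r_def)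
        qed
        then show ?thesis using A r(2) False by simp
      qed
    qed
  qed
qed

text \<open>The coefficient table of \<open>block_mat_d\<close>: label 0 stands for the block of
  order \<open>t - 1\<close>, labels 1, 2, 3 for the blocks of order \<open>t\<close>.\<close>

definition block_coeff :: "nat \<Rightarrow> nat \<Rightarrow> int" where
  "block_coeff a b = (if a = b then 3 else if a = 0 \<or> b = 0 then 1 else -1)"

text \<open>The nonzero eigenvalues of \<open>m\<close> are \<open>4t\<close>, \<open>4t\<close> and \<open>4t - 3\<close>; then \<open>y = 4t m - m\<^sup>2\<close> has rank one
  with eigenvalue \<open>3 (4t - 3)\<close>, and both \<open>y\<close> and \<open>4t m = m\<^sup>2 + y\<close> are sums of squares.\<close>

locale rank_three_gram =
  fixes n t :: nat and m y :: "nat \<Rightarrow> nat \<Rightarrow> int"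
  assumes n: "n = 4 * t - 1" and t: "0 < t"
    and sym: "i < n \<Longrightarrow> j < n \<Longrightarrow> m i j = m j i"
    and diag: "i < n \<Longrightarrow> m i i = 3"
    and odd: "i < n \<Longrightarrow> j < n \<Longrightarrow> odd (m i j)"
    and y: "i < n \<Longrightarrow> j < n \<Longrightarrow> y i j = 4 * int t * m i j - (\<Sum>k<n. m i k * m j k)"
    and gram: "i < n \<Longrightarrow> j < n \<Longrightarrow> 3 * (4 * int t - 3) * y i j = (\<Sum>k<n. y i k * y j k)"
    and trace: "(\<Sum>i<n. y i i) = 3 * (4 * int t - 3)"
begin

lemma int_n: "int n = 4 * int t - 1"
  using n t by simp

text \<open>As \<open>4t - 3 > 0\<close>, a positive multiple of \<open>y\<close> is the Gram matrix
  of the rows of \<open>y\<close>.\<close>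

lemma y_nonneg:
  assumes "i < n" "j < n" "\<epsilon> * \<epsilon> = 1"
  shows "0 \<le> y i i + y j j - 2 * \<epsilon> * y i j"
  by (rule gram_nonneg[where c = "3 * (4 * int t - 3)" and w = y and N = n]) (use t assms gram in auto)

text \<open>\<open>4t m - y\<close> is the Gram matrix of the rows of \<open>m\<close>, and
  \<open>6\<close> is the sum of two diagonal entries. Both summands on the right are nonnegative,
  which bounds \<open>m i j\<close> and makes both vanish in the extreme case.\<close>

lemma m_difference:
  assumes "i < n" "j < n" "\<epsilon> * \<epsilon> = 1"
  shows "4 * int t * (6 - 2 * \<epsilon> * m i j)
    = (\<Sum>k<n. (m i k - \<epsilon> * m j k)\<^sup>2) + (y i i + y j j - 2 * \<epsilon> * y i j)"
proof -
  have "\<forall>i<n. \<forall>j<n. 1 * (4 * int t * m i j - y i j) = (\<Sum>k<n. m i k * m j k)"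
    using y by simp
  from gram_difference[where g = "\<lambda>i j. 4 * int t * m i j - y i j" and w = m, OF this assms]
  show ?thesis using diag assms by (simp add: algebra_simps)
qed

lemma vals:
  assumes "i < n" "j < n"
  shows "m i j \<in> {1, -1, 3, -3}"
proof -
  have le: "\<epsilon> * m i j \<le> 3" if "\<epsilon> * \<epsilon> = 1" for \<epsilon>
  proof -
    have "0 \<le> 4 * int t * (6 - 2 * \<epsilon> * m i j)"
      unfolding m_difference[OF assms that]
      using y_nonneg[OF assms that] by (intro add_nonneg_nonneg sum_nonneg) auto
    then show ?thesis using t by (simp add: zero_le_mult_iff)
  qed
  from le[of 1] le[of "-1"] have "\<bar>m i j\<bar> \<le> 3" by simp
  moreover obtain b where "m i j = 2 * b + 1" using odd[OF assms] by (elim oddE)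
  ultimately show ?thesis by auto presburger+
qed

text \<open>For the matching sign the left side of \<open>m_difference\<close> is zero, so the two
  rows are equal up to that sign.\<close>

lemma row:
  assumes "i < n" "j < n" "k < n" "\<bar>m i j\<bar> = 3"
  shows "3 * m i k = m i j * m j k"
proof -
  obtain \<epsilon> where \<epsilon>: "m i j = 3 * \<epsilon>" "\<epsilon> \<in> {1, -1}"
    using vals[OF assms(1,2)] assms(4) by (auto intro: that[of 1] that[of "-1"])
  have \<epsilon>2: "\<epsilon> * \<epsilon> = 1" using \<epsilon> by auto
  have "0 = (\<Sum>k<n. (m i k - \<epsilon> * m j k)\<^sup>2) + (y i i + y j j - 2 * \<epsilon> * y i j)"
    using m_difference[OF assms(1,2) \<epsilon>2] \<epsilon> by auto
  moreover have "0 \<le> (\<Sum>k<n. (m i k - \<epsilon> * m j k)\<^sup>2)" by (intro sum_nonneg) auto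
  ultimately have "(\<Sum>k<n. (m i k - \<epsilon> * m j k)\<^sup>2) = 0"
    using y_nonneg[OF assms(1,2) \<epsilon>2] by linarith
  then have "m i k = \<epsilon> * m j k" using assms(3) by (simp add: sum_nonneg_eq_0_iff)
  then show ?thesis using \<epsilon> by simp
qed

section \<open>Classes of indices with proportional rows, and their sizes\<close>

definition cl :: "nat \<Rightarrow> nat set" where
  "cl i = {k \<in> {..<n}. \<bar>m i k\<bar> = 3}"

lemma cl_refl: "i < n \<Longrightarrow> i \<in> cl i"
  by (simp add: cl_def diag)

lemma cl_less: "k \<in> cl i \<Longrightarrow> k < n"
  by (simp add: cl_def)

lemma finite_cl [simp]: "finite (cl i)"
  by (simp add: cl_def)

text \<open>Proportional rows have entries of modulus 3 in the same places. Hence the sets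
  \<open>cl i\<close> partition the indices.\<close>

lemma cl_eq:
  assumes "i < n" "j \<in> cl i"
  shows "cl j = cl i"
proof -
  have j: "j < n" "\<bar>m i j\<bar> = 3" using assms by (auto simp: cl_def)
  have "\<bar>m j k\<bar> = \<bar>m i k\<bar>" if "k < n" for k
  proof -
    have "m i j = 3 \<or> m i j = -3" using j(2) by linarith
    then show ?thesis using row[OF assms(1) j(1) that j(2)] by auto
  qed
  then show ?thesis by (auto simp: cl_def)
qed

text \<open>Columns \<open>s\<close> and \<open>k\<close> differ by a common sign, which occurs
  twice in the product and cancels. Sums over a class thus have constant terms.\<close>

lemma cl_prod:
  assumes "s < n" "k \<in> cl s" "p < n" "q < n"
  shows "m p k * m q k = m p s * m q s"
proof -
  have k: "k < n" "\<bar>m s k\<bar> = 3" using assms by (auto simp: cl_def)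
  have "9 * (m s p * m s q) = (3 * m s p) * (3 * m s q)" by simp
  also have "\<dots> = (m s k * m s k) * (m k p * m k q)"
    unfolding row[OF assms(1) k(1) assms(3) k(2)] row[OF assms(1) k(1) assms(4) k(2)] by simp
  finally have "9 * (m s p * m s q) = (m s k * m s k) * (m k p * m k q)" .
  moreover have "m s k * m s k = 9" using abs_mult_self_eq[of "m s k"] k(2) by simp
  ultimately show ?thesis using sym assms k(1) by simp
qed

text \<open>Row \<open>i\<close> has entries of square 9 on its class and of square 1 elsewhere. In
  particular \<open>y i i = 1\<close> exactly when the class has size \<open>t\<close>.\<close>

lemma y_diag:
  assumes "i < n"
  shows "y i i = 8 * int t + 1 - 8 * int (card (cl i))"
proof -
  have "(\<Sum>k<n. m i k * m i k) = (\<Sum>k<n. 1 + (if \<bar>m i k\<bar> = 3 then 8 else 0))"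
    using vals[OF assms] by (intro sum.cong) fastforce+
  also have "\<dots> = int n + 8 * int (card (cl i))"
    by (simp add: sum.distrib cl_def flip: sum.inter_filter)
  finally show ?thesis using y[OF assms assms] diag[OF assms] int_n by simp
qed

lemma card_cl_le:
  assumes "i < n"
  shows "card (cl i) \<le> t"
proof -
  have "0 \<le> y i i" using y_nonneg[OF assms assms, where \<epsilon> = "-1"] by simp
  then show ?thesis using y_diag[OF assms] by simp
qed

text \<open>Each \<open>y i i\<close> is \<open>1\<close> plus eight times the deficiency of
  \<open>i\<close>, and the total is the prescribed trace.\<close>

lemma sum_deficiency: "(\<Sum>i<n. int t - int (card (cl i))) = int t - 1"
proof -
  have "3 * (4 * int t - 3) = (\<Sum>i<n. 1 + 8 * (int t - int (card (cl i))))"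
    unfolding trace[symmetric] by (intro sum.cong) (simp_all add: y_diag)
  also have "\<dots> = int n + 8 * (\<Sum>i<n. int t - int (card (cl i)))"
    by (simp only: sum.distrib sum_distrib_left) simp
  finally show ?thesis using int_n by simp
qed

text \<open>The indices in classes below the maximal size \<open>t\<close>. This turns out to be the
  short block, which is empty for \<open>t = 1\<close>.\<close>

definition U :: "nat set" where "U = {i \<in> {..<n}. card (cl i) < t}"
definition V :: "nat set" where "V = {..<n} - U"

lemma V_iff: "i \<in> V \<longleftrightarrow> i < n \<and> card (cl i) = t"
  using card_cl_le[of i] by (auto simp: U_def V_def)

lemma cl_subset_V:
  assumes "i \<in> V" "k \<in> cl i"
  shows "k \<in> V"
  using assms cl_eq[of i k] cl_less[of k i] by (simp add: V_iff)

lemma card_V: "int (card V) = 4 * int t - 1 - int (card U)"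
proof -
  have "card V = n - card U" unfolding V_def by (subst card_Diff_subset) (auto simp: U_def)
  moreover have "card U \<le> n" using card_mono[of "{..<n}" U] by (auto simp: U_def)
  ultimately show ?thesis using int_n by simp
qed

lemma card_classes: "t * card (cl ` V) = card V"
proof -
  have V: "\<Union> (cl ` V) = V"
  proof
    show "V \<subseteq> \<Union> (cl ` V)" using cl_refl by (auto simp: V_iff)
    show "\<Union> (cl ` V) \<subseteq> V"
    proof
      fix k assume "k \<in> \<Union> (cl ` V)"
      then obtain i where "i \<in> V" "k \<in> cl i" by auto
      then show "k \<in> V" by (rule cl_subset_V)
    qed
  qed
  have fin: "finite V" by (simp add: V_def)
  have "t * card (cl ` V) = card (\<Union> (cl ` V))"
  proof (rule card_partition)
    show "finite (\<Union> (cl ` V))" using fin V by simp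
    show "c \<inter> c' = {}" if cc: "c \<in> cl ` V" "c' \<in> cl ` V" "c \<noteq> c'" for c c'
    proof (rule ccontr)
      assume "c \<inter> c' \<noteq> {}"
      then obtain k where k: "k \<in> c" "k \<in> c'" by auto
      from cc(1,2) obtain i i' where "i < n" "i' < n" "c = cl i" "c' = cl i'" by (auto simp: V_iff)
      then show False using cl_eq[of i k] cl_eq[of i' k] k cc(3) by simp
    qed
  qed (use fin in \<open>auto simp: V_iff\<close>)
  then show ?thesis by (simp only: V)
qed

text \<open>A class of size \<open>k < t\<close> contributes \<open>k (t - k) \<ge> t - 1\<close> to the total deficiency \<open>t - 1\<close>,
  so there is at most one such class.\<close>

lemma U_class:
  assumes "i \<in> U"
  shows "cl i = U" "card U = t - 1"
proof -
  have i: "i < n" "card (cl i) < t" using assms by (auto simp: U_def)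
  define k where "k = int (card (cl i))"
  have k: "1 \<le> k" "k \<le> int t - 1"
    using i cl_refl[OF i(1)] by (auto simp: k_def Suc_le_eq card_gt_0_iff)
  have sub: "cl i \<subseteq> U"
  proof
    fix j assume "j \<in> cl i"
    then show "j \<in> U" using cl_eq[OF i(1)] i(2) by (auto simp: U_def cl_less)
  qed
  let ?d = "\<lambda>j. int t - int (card (cl j))"
  have finU: "finite U" by (simp add: U_def)
  have "k * (int t - k) + int (card (U - cl i)) = (\<Sum>j\<in>cl i. ?d j) + (\<Sum>j\<in>U - cl i. 1)"
    using cl_eq[OF i(1)] by (simp add: k_def)
  also have "\<dots> \<le> (\<Sum>j\<in>cl i. ?d j) + (\<Sum>j\<in>U - cl i. ?d j)"
    by (intro add_left_mono sum_mono) (auto simp: U_def)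
  also have "\<dots> = (\<Sum>j\<in>U. ?d j)"
    using sum.subset_diff[OF sub finU, of ?d] by simp
  also have "\<dots> \<le> (\<Sum>j<n. ?d j)"
    by (intro sum_mono2) (use card_cl_le in \<open>auto simp: U_def\<close>)
  finally have le: "k * (int t - k) + int (card (U - cl i)) \<le> int t - 1"
    using sum_deficiency by simp
  have "0 \<le> (k - 1) * (int t - 1 - k)" using k by simp
  then have "int t - 1 \<le> k * (int t - k)" by (simp add: algebra_simps)
  with le have "card (U - cl i) = 0" by simp
  then show eq: "cl i = U" using sub finU by auto
  \<comment> \<open>The complement \<open>V\<close> has \<open>4t - 1 - k\<close> elements and is a
    union of classes of size \<open>t\<close>, so \<open>t\<close> divides \<open>k + 1\<close>. As
    \<open>k \<le> t - 1\<close>, only \<open>k = t - 1\<close> remains.\<close>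
  have "k + 1 = int t * (4 - int (card (cl ` V)))"
    using card_V arg_cong[OF card_classes, of int] eq by (simp add: k_def algebra_simps)
  moreover from this have "0 < 4 - int (card (cl ` V))"
    using k t zero_less_mult_pos[of "int t" "4 - int (card (cl ` V))"] by linarith
  ultimately have "int t * 1 \<le> k + 1" by (simp only: mult_left_mono)
  then show "card U = t - 1" using k eq by (simp add: k_def)
qed

lemma card_U: "card U = t - 1"
proof (cases "U = {}")
  case True
  then have "card (cl i) = t" if "i < n" for i using card_cl_le that by (force simp: U_def)
  then have "(\<Sum>i<n. int t - int (card (cl i))) = 0" by simp
  \<comment> \<open>Zero total deficiency means \<open>t = 1\<close>, so the empty set has the right
    size \<open>t - 1\<close>.\<close>
  then show ?thesis using sum_deficiency True by simp
next
  case False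
  then show ?thesis using U_class by blast
qed

lemma card_classes_eq: "card (cl ` V) = 3"
proof -
  have "int t * int (card (cl ` V)) = int t * 3"
    using arg_cong[OF card_classes, of int] card_V card_U t by simp
  then show ?thesis using t by simp
qed

text \<open>Since \<open>y p p = y q q = 1\<close>, the entry \<open>y p q\<close> has modulus at
  most 1. Evaluated class by class, this reads
  \<open>\<bar>2 t A + t B + (t - 1) C\<bar> \<le> 1\<close> for signs \<open>A\<close>,
  \<open>B\<close>, \<open>C\<close>. It forces \<open>B = - A\<close>, and also
  \<open>C = - A\<close> once \<open>t \<ge> 2\<close>.\<close>

lemma triangle:
  assumes V: "p \<in> V" "q \<in> V" "r \<in> V"
    and ne: "cl p \<noteq> cl q" "cl p \<noteq> cl r" "cl q \<noteq> cl r"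
  shows "m p r * m q r = - m p q" "u \<in> U \<Longrightarrow> m u p * m u q = - m p q"
proof -
  have less: "p < n" "q < n" "r < n" using V by (auto simp: V_iff)
  have card: "card (cl p) = t" "card (cl q) = t" "card (cl r) = t" using V by (auto simp: V_iff)
  have disj: "cl a \<inter> cl b = {}" if "a < n" "b < n" "cl a \<noteq> cl b" for a b
    using cl_eq that by (metis disjoint_iff)
  have pm: "m a b \<in> {1, -1}" if "a < n" "b < n" "cl a \<noteq> cl b" for a b
  proof -
    have "b \<notin> cl a" using cl_eq that by metis
    then show ?thesis using vals[OF that(1,2)] that by (auto simp: cl_def)
  qed
  have clV: "cl a \<subseteq> V" if "a \<in> V" for a
    using cl_subset_V[OF that] by blast
  have dis: "cl p \<inter> cl q = {}" "(cl p \<union> cl q) \<inter> cl r = {}"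
    using disj less ne by blast+
  have finV: "finite V" by (simp add: V_def)
  have "int (card (cl p \<union> cl q \<union> cl r)) = int (card V)"
    using dis card card_V card_U t by (simp add: card_Un_disjoint)
  then have Veq: "V = cl p \<union> cl q \<union> cl r"
    using clV V finV by (intro card_subset_eq[symmetric]) auto
  have all: "{..<n} = U \<union> V" "U \<inter> V = {}" "finite U" by (auto simp: V_def U_def)
  have const: "(\<Sum>k\<in>cl s. m p k * m q k) = int t * (m p s * m q s)" if "s \<in> V" for s
  proof -
    have "s < n" "card (cl s) = t" using that by (auto simp: V_iff)
    then have "(\<Sum>k\<in>cl s. m p k * m q k) = (\<Sum>k\<in>cl s. m p s * m q s)"
      using cl_prod less by (intro sum.cong) auto
    then show ?thesis using \<open>card (cl s) = t\<close> by simp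
  qed
  \<comment> \<open>If \<open>U\<close> is empty then \<open>t - 1 = 0\<close>, and any sign may
    serve as \<open>C\<close>.\<close>
  have "\<exists>C\<in>{1, -1}. (\<Sum>k\<in>U. m p k * m q k) = (int t - 1) * C \<and> (\<forall>u\<in>U. m u p * m u q = C)"
  proof (cases "U = {}")
    case True
    then show ?thesis using card_U t by (intro bexI[of _ 1]) auto
  next
    case False
    then obtain u where u: "u \<in> U" by auto
    have un: "u < n" using u by (simp add: U_def)
    have "cl u \<noteq> cl p" "cl u \<noteq> cl q" using U_class[OF u] card_U card t by auto
    then have "m p u * m q u \<in> {1, -1}"
      using pm[of p u] pm[of q u] less un by auto
    moreover have prod: "m p k * m q k = m p u * m q u" if "k \<in> U" for k
      using cl_prod[OF un _ less(1,2)] U_class[OF u] that by simp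
    moreover have "m k p * m k q = m p u * m q u" if "k \<in> U" for k
      using prod[OF that] sym less that by (auto simp: U_def)
    ultimately show ?thesis
      using card_U t by (intro bexI[of _ "m p u * m q u"]) (auto simp: of_nat_diff)
  qed
  then obtain C where C: "C \<in> {1, -1}" "(\<Sum>k\<in>U. m p k * m q k) = (int t - 1) * C"
    "\<And>u. u \<in> U \<Longrightarrow> m u p * m u q = C" by blast
  define A where "A = m p q"
  define B where "B = m p r * m q r"
  have A: "A \<in> {1, -1}" using pm less ne by (simp add: A_def)
  have B: "B \<in> {1, -1}" using pm[of p r] pm[of q r] less ne by (auto simp: B_def)
  have "(\<Sum>k<n. m p k * m q k) = (\<Sum>k\<in>U. m p k * m q k) + (\<Sum>k\<in>V. m p k * m q k)"
    using all finV by (simp add: sum.union_disjoint)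
  also have "(\<Sum>k\<in>V. m p k * m q k) = int t * (m p p * m q p) + int t * (m p q * m q q) + int t * B"
    unfolding Veq using dis const V by (simp add: sum.union_disjoint B_def)
  \<comment> \<open>The classes of \<open>p\<close> and \<open>q\<close> contribute
    \<open>3 t A\<close> each, one factor being a diagonal entry \<open>3\<close>.\<close>
  finally have "y p q = 4 * int t * A - ((int t - 1) * C + 6 * int t * A + int t * B)"
    using y[OF less(1,2)] diag less sym[OF less(2,1)] C(2) by (simp add: A_def)
  moreover have "\<bar>y p q\<bar> \<le> 1"
    using y_nonneg[OF less(1,2), where \<epsilon> = 1] y_nonneg[OF less(1,2), where \<epsilon> = "-1"] y_diag less card by auto
  ultimately have le: "\<bar>2 * (int t * A) + int t * B + (int t - 1) * C\<bar> \<le> 1"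
    by (simp add: algebra_simps)
  show "m p r * m q r = - m p q"
    using le A B C(1) t by (fold A_def B_def) auto
  assume u: "u \<in> U"
  then have "0 < card U" using all by (auto simp: card_gt_0_iff)
  then have "2 \<le> t" using card_U by simp
  then have "C = - A" using le A B C(1) by auto
  then show "m u p * m u q = - m p q" using C(3)[OF u] by (simp add: A_def)
qed

text \<open>Signs of the class representatives are chosen so that the entries between
  representatives become those of \<open>block_coeff\<close>; every other index inherits its sign
  from its representative.\<close>

lemma signs:
  obtains \<delta> :: "nat \<Rightarrow> int" and f :: "nat \<Rightarrow> nat"
  where "\<And>i. i < n \<Longrightarrow> \<delta> i \<in> {1, -1}"
    "\<And>k. card {i \<in> {..<n}. f i = k} = (if k = 0 then t - 1 else if k \<le> 3 then t else 0)"
    "\<And>i j. i < n \<Longrightarrow> j < n \<Longrightarrow> m i j = \<delta> i * \<delta> j * block_coeff (f i) (f j)"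
proof -
  obtain A1 A2 A3 where As: "cl ` V = {A1, A2, A3}" "A1 \<noteq> A2" "A1 \<noteq> A3" "A2 \<noteq> A3"
    using card_classes_eq by (auto simp: card_3_iff)
  then have "A1 \<in> cl ` V" "A2 \<in> cl ` V" "A3 \<in> cl ` V" by simp_all
  then obtain p q r where V: "p \<in> V" "q \<in> V" "r \<in> V"
    and cls: "cl p = A1" "cl q = A2" "cl r = A3"
    by blast
  have ne: "cl p \<noteq> cl q" "cl p \<noteq> cl r" "cl q \<noteq> cl r" using As cls by auto
  have less: "p < n" "q < n" "r < n" using V by (auto simp: V_iff)
  have card: "card (cl p) = t" "card (cl q) = t" "card (cl r) = t" using V by (auto simp: V_iff)
  have disj: "cl a \<inter> cl b = {}" if "a < n" "b < n" "cl a \<noteq> cl b" for a b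
    using cl_eq that by (metis disjoint_iff)
  have dis: "cl p \<inter> cl q = {}" "cl p \<inter> cl r = {}" "cl q \<inter> cl r = {}"
    using disj less ne by blast+
  have pm: "m a b \<in> {1, -1}" if "a < n" "b < n" "cl a \<noteq> cl b" for a b
  proof -
    have "b \<notin> cl a" using cl_eq that by metis
    then show ?thesis using vals[OF that(1,2)] that by (auto simp: cl_def)
  qed
  have Veq: "V = cl p \<union> cl q \<union> cl r"
  proof
    show "V \<subseteq> cl p \<union> cl q \<union> cl r"
    proof
      fix i assume "i \<in> V"
      then have "cl i \<in> {cl p, cl q, cl r}" unfolding cls As(1)[symmetric] by (rule imageI)
      moreover have "i \<in> cl i" using \<open>i \<in> V\<close> cl_refl by (simp add: V_iff)
      ultimately show "i \<in> cl p \<union> cl q \<union> cl r" by blast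
    qed
    show "cl p \<union> cl q \<union> cl r \<subseteq> V"
      using V cl_subset_V by blast
  qed
  have Un: "U \<subseteq> {..<n}" "{..<n} = U \<union> V" "U \<inter> V = {}" by (auto simp: V_def U_def)
  \<comment> \<open>For empty \<open>U\<close> this is an unspecified number, but label 0 is then
    not a value of \<open>f\<close>.\<close>
  define u where "u = (SOME u. u \<in> U)"
  have u: "u \<in> U" if "i \<in> U" for i using someI[of "\<lambda>u. u \<in> U", OF that] by (simp add: u_def)
  \<comment> \<open>If \<open>U\<close> is nonempty, \<open>p\<close>, \<open>q\<close>,
    \<open>r\<close> are normalized to be positive against \<open>u\<close>. Otherwise
    \<open>q\<close> and \<open>r\<close> are normalized to be negative against \<open>p\<close>,
    and \<open>triangle\<close> then settles the pair \<open>q\<close>, \<open>r\<close>.\<close>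
  define e where "e a = (if a = 0 then 1 else if U \<noteq> {} then m u (if a = 1 then p else if a = 2 then q else r)
    else if a = 1 then 1 else if a = 2 then - m p q else - m p r)" for a :: nat
  define \<rho> where "\<rho> a = (if a = 0 then u else if a = 1 then p else if a = 2 then q else r)" for a :: nat
  define f where "f i = (if i \<in> U then 0 else if i \<in> cl p then 1 else if i \<in> cl q then 2 else 3 :: nat)" for i
  define \<delta> where "\<delta> i = e (f i) * sgn (m (\<rho> (f i)) i)" for i
  have u_pm: "m u p \<in> {1, -1}" "m u q \<in> {1, -1}" "m u r \<in> {1, -1}" if nonempty: "U \<noteq> {}"
  proof -
    obtain i where "i \<in> U" using nonempty by auto
    then have uU: "u \<in> U" by (rule u)
    then have "u < n" using Un by auto
    moreover have "cl u \<noteq> cl p" "cl u \<noteq> cl q" "cl u \<noteq> cl r" using U_class[OF uU] card_U card t by auto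
    ultimately show "m u p \<in> {1, -1}" "m u q \<in> {1, -1}" "m u r \<in> {1, -1}"
      using pm less by auto
  qed
  note pms = pm[OF less(1,2) ne(1)] pm[OF less(1,3) ne(2)] pm[OF less(2,3) ne(3)]
  have e: "e a \<in> {1, -1}" for a using u_pm pms by (auto simp: e_def)
  have f_le: "f i \<le> 3" for i by (simp add: f_def)
  have rep: "\<rho> (f i) < n" "\<bar>m (\<rho> (f i)) i\<bar> = 3" if i: "i < n" for i
  proof -
    have "i \<in> cl (\<rho> (f i)) \<and> \<rho> (f i) < n"
    proof (cases "i \<in> U")
      case True
      from u[OF this] have "u \<in> U" .
      then show ?thesis using True U_class(1)[of u] Un by (auto simp: f_def \<rho>_def)
    next
      case False
      then have "i \<in> V" using Un i by auto
      then show ?thesis using False Veq less by (auto simp: f_def \<rho>_def)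
    qed
    then show "\<rho> (f i) < n" "\<bar>m (\<rho> (f i)) i\<bar> = 3" by (auto simp: cl_def)
  qed
  have edge: "m p q = - (e 1 * e 2)" "m p r = - (e 1 * e 3)" "m q r = - (e 2 * e 3)"
  proof -
    have t1: "m p r * m q r = - m p q" using triangle[OF V ne] by simp
    show "m p q = - (e 1 * e 2)" "m p r = - (e 1 * e 3)" "m q r = - (e 2 * e 3)"
    proof (atomize (full), cases "U = {}")
      case True
      then show "m p q = - (e 1 * e 2) \<and> m p r = - (e 1 * e 3) \<and> m q r = - (e 2 * e 3)"
        using t1 pms by (auto simp: e_def)
    next
      case False
      then obtain i where "i \<in> U" by auto
      then have uU: "u \<in> U" by (rule u)
      show "m p q = - (e 1 * e 2) \<and> m p r = - (e 1 * e 3) \<and> m q r = - (e 2 * e 3)"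
        \<comment> \<open>Each of the three pairs is compared through \<open>u\<close>, the
          remaining representative acting as the third class.\<close>
        using triangle(2)[OF V ne uU] triangle(2)[OF V(1,3,2) ne(2,1) ne(3)[symmetric] uU]
          triangle(2)[OF V(2,3,1) ne(3) ne(1,2)[symmetric] uU] False
        by (simp add: e_def)
    qed
  qed
  have core: "m (\<rho> a) (\<rho> b) = e a * e b * block_coeff a b"
    if a: "a \<le> b" "b \<le> 3" "a = 0 \<longrightarrow> U \<noteq> {}" for a b
  proof -
    have un: "u < n" if "a = 0" using a(3) u Un that by blast
    have "a = 0 \<or> a = 1 \<or> a = 2 \<or> a = 3" "b = 0 \<or> b = 1 \<or> b = 2 \<or> b = 3" using a by auto
    then consider "a = b" | "a = 0" "b \<in> {1,2,3}" | "a = 1" "b = 2" | "a = 1" "b = 3" | "a = 2" "b = 3"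
      using a(1) by fastforce
    then show ?thesis
    proof cases
      case 1
      have "\<rho> a < n" using un less by (auto simp: \<rho>_def)
      moreover have "e a * e a = 1" using e[of a] by auto
      ultimately show ?thesis using 1 diag by (simp add: block_coeff_def)
    next
      case 2
      then show ?thesis using a(3) by (auto simp: \<rho>_def e_def block_coeff_def)
    qed (use edge in \<open>simp_all add: \<rho>_def block_coeff_def\<close>)
  qed
  have core': "m (\<rho> (f i)) (\<rho> (f j)) = e (f i) * e (f j) * block_coeff (f i) (f j)"
    if ij: "i < n" "j < n" for i j
  proof -
    have 0: "f k = 0 \<Longrightarrow> U \<noteq> {}" for k by (auto simp: f_def split: if_splits)
    show ?thesis
    proof (cases "f i \<le> f j")
      case True
      then show ?thesis using core[OF True f_le] 0 by auto
    next
      case False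
      have "m (\<rho> (f j)) (\<rho> (f i)) = e (f j) * e (f i) * block_coeff (f j) (f i)"
        using core[of "f j" "f i"] False f_le 0 by auto
      then show ?thesis using sym[OF rep(1)[OF ij(1)] rep(1)[OF ij(2)]]
        by (auto simp: block_coeff_def)
    qed
  qed
  have sgn_row: "m i k = sgn (m (\<rho> (f i)) i) * m (\<rho> (f i)) k" if "i < n" "k < n" for i k
  proof -
    have "m (\<rho> (f i)) i = 3 \<or> m (\<rho> (f i)) i = -3" using rep(2)[OF that(1)] by linarith
    then show ?thesis using row[OF rep(1)[OF that(1)] that rep(2)[OF that(1)]] by auto
  qed
  show thesis
  proof (rule that)
    show "\<delta> i \<in> {1, -1}" if "i < n" for i
      using e[of "f i"] rep(2)[OF that] by (auto simp: \<delta>_def sgn_if)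
    show "m i j = \<delta> i * \<delta> j * block_coeff (f i) (f j)" if ij: "i < n" "j < n" for i j
    proof -
      have "m i j = sgn (m (\<rho> (f i)) i) * m j (\<rho> (f i))"
        using sgn_row[OF ij] sym[OF rep(1)[OF ij(1)] ij(2)] by simp
      also have "m j (\<rho> (f i)) = sgn (m (\<rho> (f j)) j) * m (\<rho> (f i)) (\<rho> (f j))"
        using sgn_row[OF ij(2) rep(1)[OF ij(1)]] sym[OF rep(1)[OF ij(1)] rep(1)[OF ij(2)]] by simp
      finally show ?thesis using core'[OF ij] by (simp add: \<delta>_def)
    qed
    show "card {i \<in> {..<n}. f i = k} = (if k = 0 then t - 1 else if k \<le> 3 then t else 0)" for k
    proof -
      have "{i \<in> {..<n}. f i = k} = (if k = 0 then U else if k = 1 then cl p else if k = 2 then cl q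
          else if k = 3 then cl r else {})"
        unfolding f_def using Un Veq dis by auto
      then show ?thesis using card_U card by auto
    qed
  qed
qed

end

section \<open>Spectra of Seidel matrices\<close>

text \<open>Keeping one pair \<open>P\<close>, \<open>Q\<close> fixed lets polynomial identities of
  a block matrix be transported to the matrix similar to it.\<close>

lemma similar_mat_wit_mult:
  assumes "A \<in> carrier_mat n n" "A' \<in> carrier_mat n n"
    and "similar_mat_wit A B P Q" "similar_mat_wit A' B' P Q"
  shows "similar_mat_wit (A * A') (B * B') P Q"
proof -
  note A = similar_mat_witD2[OF assms(1,3)] and A' = similar_mat_witD2[OF assms(2,4)]
  have "A * A' = P * B * (Q * P) * B' * Q"
    unfolding A(3) A'(3) using A(5-) A'(5-) by (simp add: assoc_mult_mat[of _ n n _ n _ n])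
  also have "\<dots> = P * (B * B') * Q"
    unfolding A(2) using A(5-) A'(5-) by (simp add: assoc_mult_mat[of _ n n _ n _ n])
  finally show ?thesis
    by (rule similar_mat_witI[OF A(1,2)]) (use A(4-) A'(4-) in auto)
qed

lemma similar_mat_wit_minus:
  fixes A :: "'a :: ring_1 mat"
  assumes "A \<in> carrier_mat n n" "A' \<in> carrier_mat n n"
    and "similar_mat_wit A B P Q" "similar_mat_wit A' B' P Q"
  shows "similar_mat_wit (A - A') (B - B') P Q"
proof -
  note A = similar_mat_witD2[OF assms(1,3)] and A' = similar_mat_witD2[OF assms(2,4)]
  have "A - A' = P * (B - B') * Q"
    unfolding A(3) A'(3) using A(5-) A'(5-)
    by (simp add: mult_minus_distrib_mat[of _ n n _ n] minus_mult_distrib_mat[of _ n n _ _ n])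
  then show ?thesis
    by (rule similar_mat_witI[OF A(1,2)]) (use A(4-) A'(4-) in auto)
qed

lemma similar_mat_wit_scaled:
  fixes A :: "'a :: comm_ring_1 mat"
  assumes "A \<in> carrier_mat n n" and "similar_mat_wit A B P Q"
  shows "similar_mat_wit (c \<cdot>\<^sub>m A) (c \<cdot>\<^sub>m B) P Q"
proof -
  note A = similar_mat_witD2[OF assms]
  have "c \<cdot>\<^sub>m A = P * (c \<cdot>\<^sub>m B) * Q"
    unfolding A(3) using A(5-)
    by (simp add: mult_smult_distrib[of _ n n _ n] mult_smult_assoc_mat[of _ n n _ n])
  then show ?thesis
    by (rule similar_mat_witI[OF A(1,2)]) (use A(4-) in auto)
qed

lemma similar_mat_wit_unique:
  "similar_mat_wit A B P Q \<Longrightarrow> similar_mat_wit A' B P Q \<Longrightarrow> A = A'"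
  using similar_mat_witD(3)[OF refl] by metis

lemma similar_mat_wit_trace:
  fixes A :: "'a :: comm_ring_1 mat"
  assumes "similar_mat_wit A B P Q"
  shows "mat_trace A = mat_trace B"
proof -
  obtain n where n: "n = dim_row A" by simp
  note A = similar_mat_witD[OF n assms]
  show ?thesis unfolding A(3) using A(5-) A(2) by (intro mat_trace_conj) auto
qed

text \<open>Turns a trace into a count of eigenvalues.\<close>

lemma sum_list_indicator:
  fixes c :: "'a :: semiring_1"
  assumes "\<And>e. e \<in> set es \<Longrightarrow> f e = (if R e then c else 0)"
  shows "(\<Sum>e\<leftarrow>es. f e) = of_nat (length (filter R es)) * c"
  using assms by (induction es) (auto simp: algebra_simps)

section \<open>Diagonal and parity of the square of a Seidel matrix\<close>

lemma seidel_mat_entries: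
  assumes "seidel_mat S" "S \<in> carrier_mat n n" "i < n"
  shows "S $$ (i, i) = 0" "j < n \<Longrightarrow> j \<noteq> i \<Longrightarrow> S $$ (i, j) \<in> {1, -1}"
proof -
  have S: "\<forall>i<n. \<forall>j<n. S $$ (i, j) \<in> {0, 1, -1}" "\<forall>i<n. S $$ (i, i) = 0"
    "\<forall>i<n. \<forall>j<n. i \<noteq> j \<longrightarrow> S $$ (i, j) \<noteq> 0"
    using assms(1,2) unfolding seidel_mat_def by auto
  show "S $$ (i, i) = 0" using S(2) assms(3) by blast
  assume j: "j < n" "j \<noteq> i"
  then have "S $$ (i, j) \<noteq> 0" using S(3) assms(3) by metis
  then show "S $$ (i, j) \<in> {1, -1}" using S(1) assms(3) j by blast
qed

text \<open>Both types satisfy \<open>S = c \<cdot>\<^sub>m S\<^sup>T\<close> with \<open>c\<close>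
  equal to \<open>1\<close> or \<open>-1\<close>. A diagonal entry of the square is then a sum of
  \<open>n - 1\<close> terms \<open>c\<close>.\<close>

lemma seidel_mat_cases:
  assumes "seidel_mat S" "S \<in> carrier_mat n n"
  shows "0 < n" "mat_trace S = 0"
    and "(S\<^sup>T = S \<and> (\<forall>i<n. (S * S) $$ (i, i) = int n - 1))
      \<or> (\<forall>i<n. (S * S) $$ (i, i) = - (int n - 1))"
proof -
  note s = seidel_mat_entries[OF assms]
  show "0 < n" "mat_trace S = 0"
    using assms s by (auto simp: seidel_mat_def mat_trace_def)
  have diag: "(S * S) $$ (i, i) = c * (int n - 1)"
    if "S = c \<cdot>\<^sub>m S\<^sup>T" and i: "i < n" for c i
  proof -
    have "S $$ (k, i) = c * S $$ (i, k)" if "k < n" for k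
      using arg_cong[OF \<open>S = c \<cdot>\<^sub>m S\<^sup>T\<close>, of "\<lambda>A. A $$ (k, i)"] that i assms(2) by simp
    then have "(S * S) $$ (i, i) = (\<Sum>k<n. if k = i then 0 else c)"
      unfolding mult_mat_entry[OF assms(2,2) i i] using s[OF i]
      by (intro sum.cong) fastforce+
    also have "\<dots> = (\<Sum>k\<in>{..<n} - {i}. c)"
      by (rule sum.mono_neutral_cong_right) auto
    finally show ?thesis using i by (simp add: of_nat_diff)
  qed
  have "S = S\<^sup>T \<or> S = - S\<^sup>T" using assms by (auto simp: seidel_mat_def)
  then show "(S\<^sup>T = S \<and> (\<forall>i<n. (S * S) $$ (i, i) = int n - 1))
      \<or> (\<forall>i<n. (S * S) $$ (i, i) = - (int n - 1))"
  proof
    assume "S = S\<^sup>T"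
    moreover from this have "S = 1 \<cdot>\<^sub>m S\<^sup>T" by (intro eq_matI) auto
    ultimately show ?thesis using diag[of 1] by auto
  next
    assume "S = - S\<^sup>T"
    then have "S = (-1) \<cdot>\<^sub>m S\<^sup>T" using assms(2) by (intro eq_matI) (metis carrier_matD index_smult_mat(1-3) index_uminus_mat(1-3) mult_minus1)+
    then show ?thesis using diag[of "-1"] by auto
  qed
qed

text \<open>In the sum for the entry, the terms \<open>k = i\<close> and \<open>k = j\<close> vanish
  and the other \<open>n - 2\<close> are odd.\<close>

lemma seidel_mat_square_parity:
  assumes "seidel_mat S" "S \<in> carrier_mat n n" "i < n" "j < n" "i \<noteq> j"
  shows "even ((S * S) $$ (i, j)) \<longleftrightarrow> even n"
proof -
  have s: "S $$ (k, k) = 0" "l < n \<Longrightarrow> l \<noteq> k \<Longrightarrow> odd (S $$ (k, l))" if "k < n" for k l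
    using seidel_mat_entries(1)[OF assms(1,2) that] seidel_mat_entries(2)[OF assms(1,2) that, of l] by auto
  have "{k \<in> {..<n}. odd (S $$ (i, k) * S $$ (k, j))} = {..<n} - {i, j}"
    using s assms(3-5) by auto
  then have "even ((S * S) $$ (i, j)) \<longleftrightarrow> even (n - 2)"
    unfolding mult_mat_entry[OF assms(2,2,3,4)] using assms(3-5)
    by (subst even_sum_iff) (auto simp: card_Diff_subset)
  moreover have "2 \<le> n" using assms(3-5) by auto
  ultimately show ?thesis by simp
qed

lemma transpose_scaled: "(c \<cdot>\<^sub>m A)\<^sup>T = c \<cdot>\<^sub>m A\<^sup>T"
  by (intro eq_matI) auto

section \<open>The eigenvalues \<open>\<plusminus> sqrt (4t + 1)\<close> and the candidate
  spectra\<close>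

definition surd :: "nat \<Rightarrow> complex" where
  "surd t = complex_of_real (sqrt (4 * real t + 1))"

lemma surd_square: "surd t * surd t = 4 * of_nat t + 1"
proof -
  have "surd t * surd t = complex_of_real (sqrt (4 * real t + 1) * sqrt (4 * real t + 1))"
    by (simp only: surd_def of_real_mult)
  also have "\<dots> = 4 * of_nat t + 1" by simp
  finally show ?thesis .
qed

lemma eq_surd_iff: "e * e = 4 * of_nat t + 1 \<longleftrightarrow> e = surd t \<or> e = - surd t"
  using square_eq_iff[of e "surd t"] by (simp add: surd_square)

lemma norm_surd: "0 < t \<Longrightarrow> 2 < norm (surd t)"
  by (simp add: surd_def real_less_rsqrt)

text \<open>\<open>F\<close> lists the exceptional eigenvalues, and \<open>k\<close> is the exponent
  of \<open>x^2 - 4t - 1\<close>.\<close>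

abbreviation spec :: "complex list \<Rightarrow> nat \<Rightarrow> nat \<Rightarrow> complex list" where
  "spec F k t \<equiv> F @ replicate k (surd t) @ replicate k (- surd t)"

lemma quadratic_hom:
  fixes x :: "int poly" defines "x \<equiv> [:0, 1:]"
  shows "map_poly of_int ((x ^ 2 - 4 * of_nat t - 1) ^ k) = (\<Prod>e\<leftarrow>spec [] k t. [:- e, 1:])"
proof -
  have "x ^ 2 - 4 * of_nat t - 1 = [:- (4 * int t + 1), 0, 1:]"
    by (simp add: x_def power2_eq_square of_nat_poly numeral_poly one_pCons)
  also have "map_poly of_int \<dots> = [:- (surd t * surd t), 0, 1:]"
    by (simp add: surd_square)
  also have "\<dots> = [:- surd t, 1:] * [:surd t, 1:]"
    by simp
  finally have "map_poly of_int (x ^ 2 - 4 * of_nat t - 1) = [:- surd t, 1:] * [:surd t, 1:]" .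
  then show ?thesis
    by (simp add: of_int_poly_hom.hom_power power_mult_distrib del: mult_pCons_left mult_pCons_right)
qed

section \<open>The matrix \<open>M\<close> as \<open>gap t\<close>, and spectra of prescribed
  shape\<close>

context triangularized
begin

definition gap :: "nat \<Rightarrow> int mat" where
  "gap t = int (4 * t + 1) \<cdot>\<^sub>m 1\<^sub>m n - S * S"

lemma gap_carrier: "gap t \<in> carrier_mat n n"
  using S by (auto simp: gap_def)

lemma acts_as_gap: "acts_as (gap t) (\<lambda>e. 4 * of_nat t + 1 - e * e)"
  using acts_as_minus[OF acts_as_smult[OF acts_as_one, of "int (4 * t + 1)"] acts_as_mult[OF acts_as_S acts_as_S]]
  by (simp add: gap_def add.commute)

lemma gap_entry: "i < n \<Longrightarrow> j < n \<Longrightarrow> gap t $$ (i, j) = (if i = j then int (4 * t + 1) else 0) - (S * S) $$ (i, j)"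
  using S by (simp add: gap_def)

lemma gap_symmetric: "S\<^sup>T = S \<Longrightarrow> (gap t)\<^sup>T = gap t"
  using S by (simp add: gap_def transpose_minus[of _ n n] transpose_mult[of _ n n _ n] transpose_scaled)

lemma sum_spec:
  assumes "mset es = mset (spec F k t)"
  shows "(\<Sum>e\<leftarrow>es. f e) = (\<Sum>e\<leftarrow>F. f e) + of_nat k * (f (surd t) + f (- surd t))"
proof -
  have "(\<Sum>e\<leftarrow>es. f e) = (\<Sum>e\<leftarrow>spec F k t. f e)"
    by (metis assms mset_map sum_mset_sum_list)
  then show ?thesis by (simp add: sum_list_replicate algebra_simps)
qed

lemma length_spec: "mset es = mset (spec F k t) \<Longrightarrow> n = length F + 2 * k"
  using len by (metis add.assoc length_append length_replicate mult_2 size_mset)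

lemma set_spec: "mset es = mset (spec F k t) \<Longrightarrow> e \<in> set es \<Longrightarrow> e \<in> set F \<or> e * e = 4 * of_nat t + 1"
  using mset_eq_setD[of es "spec F k t"] by (auto simp: surd_square split: if_splits)

text \<open>A skew-symmetric \<open>S\<close> would have \<open>tr S\<^sup>2 = -n(n - 1)\<close>.\<close>

lemma spec_symmetric:
  assumes "seidel_mat S" "mset es = mset (spec F k t)" "2 \<le> n"
    and "(\<Sum>e\<leftarrow>F. e * e) + of_nat (2 * k) * (4 * of_nat t + 1) = of_nat n * (of_nat n - 1)"
  shows "S\<^sup>T = S" "i < n \<Longrightarrow> (S * S) $$ (i, i) = int n - 1"
proof -
  have "of_int (mat_trace (S * S)) = (\<Sum>e\<leftarrow>es. e * e)"
    by (intro mat_trace_acts_as acts_as_mult acts_as_S)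
  also have "\<dots> = of_int (int n * (int n - 1))"
    unfolding sum_spec[OF assms(2)] using assms(4) by (simp add: surd_square algebra_simps)
  finally have tr: "mat_trace (S * S) = int n * (int n - 1)" by (simp only: of_int_eq_iff)
  have "\<not> (\<forall>i<n. (S * S) $$ (i, i) = - (int n - 1))"
  proof
    assume "\<forall>i<n. (S * S) $$ (i, i) = - (int n - 1)"
    then have "mat_trace (S * S) = int n * - (int n - 1)" using S by (simp add: mat_trace_def)
    then have "int n * (int n - 1) = 0" using tr by simp
    then show False using assms(3) by simp
  qed
  then show "S\<^sup>T = S" "i < n \<Longrightarrow> (S * S) $$ (i, i) = int n - 1"
    using seidel_mat_cases(3)[OF assms(1) S] by auto
qed

text \<open>With \<open>p\<close> and \<open>q\<close> the multiplicities of the two surds, trace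
  zero gives \<open>sum_list F = (q - p) * surd t\<close>. As \<open>p + q\<close> is even, so is
  \<open>q - p\<close>; if it were nonzero, the norm would exceed \<open>2 * 2 = 4\<close>.\<close>

lemma spec_balanced:
  assumes t: "0 < t" and trace: "mat_trace S = 0"
    and F: "mset (filter (\<lambda>e. e * e \<noteq> 4 * of_nat t + 1) es) = mset F"
    and n: "n = length F + 2 * k"
    and small: "norm (sum_list F) \<le> 4"
  shows "mset es = mset (spec F k t)" "sum_list F = 0"
proof -
  define p q where "p = count (mset es) (surd t)" and "q = count (mset es) (- surd t)"
  have root: "surd t \<noteq> - surd t" using norm_surd[OF t] by (auto simp: eq_neg_iff_add_eq_0)
  have es: "mset es = mset F + replicate_mset p (surd t) + replicate_mset q (- surd t)"
  proof (rule multiset_eqI)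
    fix e
    have "count (mset F) e = (if e = surd t \<or> e = - surd t then 0 else count (mset es) e)"
      unfolding F[symmetric] mset_filter by (simp add: eq_surd_iff)
    then show "count (mset es) e = count (mset F + replicate_mset p (surd t) + replicate_mset q (- surd t)) e"
      using root by (auto simp: p_def q_def)
  qed
  have pq: "p + q = 2 * k" using arg_cong[OF es, of size] len n by simp
  have "(\<Sum>e\<leftarrow>es. e) = 0" using mat_trace_acts_as[OF acts_as_S] trace by simp
  then have "sum_mset (mset es) = 0" by (simp add: sum_mset_sum_list)
  then have sum: "sum_list F = of_int (int q - int p) * surd t"
    unfolding es by (simp add: sum_mset_sum_list algebra_simps)
  have "p = q"
  proof (rule ccontr)
    assume "p \<noteq> q"
    have "even (int q - int p)" using pq by (metis dvd_triv_left even_add even_diff even_of_nat)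
    then have "2 \<le> \<bar>int q - int p\<bar>" using \<open>p \<noteq> q\<close> by presburger
    then have "2 * norm (surd t) \<le> \<bar>of_int (int q - int p)\<bar> * norm (surd t)"
      by (intro mult_right_mono norm_ge_zero) linarith
    also have "\<dots> = norm (sum_list F)" unfolding sum norm_mult by (simp only: norm_of_int)
    finally show False using small norm_surd[OF t] by simp
  qed
  moreover from this have "q = k" using pq by simp
  ultimately show "mset es = mset (spec F k t)" using es by simp
  from \<open>p = q\<close> show "sum_list F = 0" using sum by simp
qed

end

section \<open>The block matrices\<close>

lemma symmetric_square_entry:
  assumes "A \<in> carrier_mat n n" "A\<^sup>T = A" "i < n" "j < n"
  shows "(A * A) $$ (i, j) = (\<Sum>k<n. A $$ (i, k) * A $$ (j, k))"
proof -
  have "A $$ (k, j) = A $$ (j, k)" if "k < n" for k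
    using assms that by (metis carrier_matD index_transpose_mat(1))
  then show ?thesis unfolding mult_mat_entry[OF assms(1,1,3,4)] by simp
qed

lemma block_mat_c_carrier: "block_mat_c t \<in> carrier_mat (4 * t) (4 * t)"
  by (rule carrier_matI) (simp_all add: block_mat_c_def all_ones_def)

lemma block_mat_c_entry:
  assumes "i < 4 * t" "j < 4 * t"
  shows "block_mat_c t $$ (i, j) = (if (i < 2 * t) = (j < 2 * t) then 2 else 0)"
proof -
  have "block_mat_c t $$ (i, j) = (if i < 2 * t then if j < 2 * t then 2 else 0 else if j < 2 * t then 0 else 2)"
    using assms unfolding block_mat_c_def
    by (cases "i < 2 * t"; cases "j < 2 * t"; simp add: all_ones_def)
  then show ?thesis by auto
qed

lemma sum_block_c:
  fixes h :: "bool \<Rightarrow> int"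
  shows "(\<Sum>k<4 * t. h (k < 2 * t)) = int (2 * t) * (h True + h False)"
proof -
  have "(\<Sum>k<4 * t. h (k < 2 * t)) = (\<Sum>k=0..<2 * t. h (k < 2 * t)) + (\<Sum>k=2 * t..<4 * t. h (k < 2 * t))"
    by (subst sum.atLeastLessThan_concat) (auto simp: atLeast0LessThan)
  then show ?thesis by (simp add: algebra_simps)
qed

section \<open>Block labels and block sums for the matrix in (d)\<close>

definition block_d :: "nat \<Rightarrow> nat \<Rightarrow> nat" where
  "block_d t i = (if i < t - 1 then 0 else if i < 2 * t - 1 then 1 else if i < 3 * t - 1 then 2 else 3)"

lemma block_mat_d_carrier:
  assumes "0 < t"
  shows "block_mat_d t \<in> carrier_mat (4 * t - 1) (4 * t - 1)"
proof -
  obtain s where t: "t = Suc s" using assms gr0_implies_Suc by auto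
  show ?thesis by (rule carrier_matI) (simp_all add: t block_mat_d_def all_ones_def)
qed

lemma block_mat_d_entry:
  assumes "0 < t" "i < 4 * t - 1" "j < 4 * t - 1"
  shows "block_mat_d t $$ (i, j) = block_coeff (block_d t i) (block_d t j)"
proof -
  obtain s where t: "t = Suc s" using assms(1) gr0_implies_Suc by auto
  show ?thesis
    using assms(2,3) unfolding t block_mat_d_def block_d_def block_coeff_def
    \<comment> \<open>With \<open>t = Suc s\<close> the block boundaries \<open>t - 1\<close>,
      \<open>2 t - 1\<close>, \<open>3 t - 1\<close> become \<open>s\<close>,
      \<open>2 s + 1\<close>, \<open>3 s + 2\<close>, free of truncated subtraction.\<close>
    by (cases "i < s"; cases "i < 2 * s + 1"; cases "i < 3 * s + 2";
        cases "j < s"; cases "j < 2 * s + 1"; cases "j < 3 * s + 2";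
        (simp add: all_ones_def)?; arith?)
qed

text \<open>Splitting the range at the block boundaries reduces matrix products of order
  \<open>4t - 1\<close> to a check over four labels.\<close>

lemma sum_block_d:
  fixes h :: "nat \<Rightarrow> int"
  assumes "0 < t"
  shows "(\<Sum>k<4 * t - 1. h (block_d t k)) = int (t - 1) * h 0 + int t * (h 1 + h 2 + h 3)"
proof -
  let ?s = "\<lambda>a b. \<Sum>k=a..<b. h (block_d t k)"
  have "(\<Sum>k<4 * t - 1. h (block_d t k)) = ?s 0 (t - 1) + ?s (t - 1) (2 * t - 1) + ?s (2 * t - 1) (3 * t - 1)
      + ?s (3 * t - 1) (4 * t - 1)"
  proof -
    have concat: "?s a b + ?s b c = ?s a c" if "a \<le> b" "b \<le> c" for a b c
      using that by (rule sum.atLeastLessThan_concat)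
    show ?thesis using assms by (simp only: concat atLeast0LessThan[symmetric])
  qed
  also have "?s 0 (t - 1) = (\<Sum>k=0..<t - 1. h 0)"
    by (intro sum.cong) (auto simp: block_d_def)
  also have "?s (t - 1) (2 * t - 1) = (\<Sum>k=t - 1..<2 * t - 1. h 1)"
    by (intro sum.cong) (auto simp: block_d_def)
  also have "?s (2 * t - 1) (3 * t - 1) = (\<Sum>k=2 * t - 1..<3 * t - 1. h 2)"
    using assms by (intro sum.cong) (auto simp: block_d_def)
  also have "?s (3 * t - 1) (4 * t - 1) = (\<Sum>k=3 * t - 1..<4 * t - 1. h 3)"
    using assms by (intro sum.cong) (auto simp: block_d_def)
  finally show ?thesis using assms by (simp add: algebra_simps)
qed

lemma card_block_d:
  assumes "0 < t"
  shows "card {i \<in> {..<4 * t - 1}. block_d t i = k} = (if k = 0 then t - 1 else if k \<le> 3 then t else 0)"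
proof -
  have "int (card {i \<in> {..<4 * t - 1}. block_d t i = k}) = (\<Sum>i<4 * t - 1. if block_d t i = k then 1 else 0)"
    by (simp flip: sum.inter_filter)
  also have "\<dots> = int (if k = 0 then t - 1 else if k \<le> 3 then t else 0)"
    using sum_block_d[OF assms, of "\<lambda>b. if b = k then 1 else 0"] by auto
  finally show ?thesis by (simp only: of_nat_eq_iff)
qed

lemma all_ones_carrier: "all_ones k k \<in> carrier_mat k k"
  by (simp add: all_ones_def)

lemma all_ones_square: "all_ones k k * all_ones k k = int k \<cdot>\<^sub>m all_ones k k"
proof (rule eq_matI)
  fix i j assume "i < dim_row (int k \<cdot>\<^sub>m all_ones k k)" "j < dim_col (int k \<cdot>\<^sub>m all_ones k k)"
  then have ij: "i < k" "j < k" by (auto simp: all_ones_def)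
  show "(all_ones k k * all_ones k k) $$ (i, j) = (int k \<cdot>\<^sub>m all_ones k k) $$ (i, j)"
    unfolding mult_mat_entry[OF all_ones_carrier all_ones_carrier ij] using ij by (simp add: all_ones_def)
qed (auto simp: all_ones_def)

text \<open>On each diagonal block, \<open>(2J)^2 = 4 (2t) J = 4t (2J)\<close>.\<close>

lemma block_mat_c_square: "block_mat_c t * block_mat_c t = int (4 * t) \<cdot>\<^sub>m block_mat_c t"
proof (rule eq_matI)
  fix i j assume "i < dim_row (int (4 * t) \<cdot>\<^sub>m block_mat_c t)" "j < dim_col (int (4 * t) \<cdot>\<^sub>m block_mat_c t)"
  then have ij: "i < 4 * t" "j < 4 * t" using block_mat_c_carrier[of t] by auto
  define h where "h b = (if (i < 2 * t) = b then 2 else 0) * (if b = (j < 2 * t) then 2 else 0 :: int)" for b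
  have "(block_mat_c t * block_mat_c t) $$ (i, j) = (\<Sum>k<4 * t. h (k < 2 * t))"
    unfolding mult_mat_entry[OF block_mat_c_carrier block_mat_c_carrier ij]
    using ij by (intro sum.cong) (auto simp: block_mat_c_entry h_def)
  also have "\<dots> = (int (4 * t) \<cdot>\<^sub>m block_mat_c t) $$ (i, j)"
    unfolding sum_block_c using ij block_mat_c_carrier[of t] by (auto simp: block_mat_c_entry h_def)
  finally show "(block_mat_c t * block_mat_c t) $$ (i, j) = (int (4 * t) \<cdot>\<^sub>m block_mat_c t) $$ (i, j)" .
qed (use block_mat_c_carrier[of t] in auto)

text \<open>The vector \<open>(3, 1, 1, 1)\<close>, constant on blocks, spans the eigenspace for \<open>4t - 3\<close>.\<close>

definition block_vec :: "nat \<Rightarrow> int" where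
  "block_vec b = (if b = 0 then 3 else 1)"

lemma block_d_less: "block_d t i \<in> {0, 1, 2, 3}"
  by (simp add: block_d_def)

text \<open>The polynomial \<open>4t x - x^2\<close> kills the eigenvalues \<open>0\<close> and
  \<open>4t\<close>, so only the eigenvector of \<open>4t - 3\<close> survives. The scaling agrees:
  \<open>3 (4t - 3)\<close> is its squared norm \<open>9 (t - 1) + 3 t\<close>.\<close>

lemma block_mat_d_quadratic:
  assumes "0 < t" "i < 4 * t - 1" "j < 4 * t - 1"
  shows "(int (4 * t) \<cdot>\<^sub>m block_mat_d t - block_mat_d t * block_mat_d t) $$ (i, j)
    = block_vec (block_d t i) * block_vec (block_d t j)"
proof -
  note c = block_mat_d_carrier[OF assms(1)]
  define h where "h b = block_coeff (block_d t i) b * block_coeff b (block_d t j)" for b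
  have "(block_mat_d t * block_mat_d t) $$ (i, j) = (\<Sum>k<4 * t - 1. h (block_d t k))"
    unfolding mult_mat_entry[OF c c assms(2,3)]
    using assms by (intro sum.cong) (auto simp: block_mat_d_entry h_def)
  also have "\<dots> = int (t - 1) * h 0 + int t * (h 1 + h 2 + h 3)"
    by (rule sum_block_d[OF assms(1)])
  finally show ?thesis
    using assms c block_d_less[of t i] block_d_less[of t j]
    by (auto simp: block_mat_d_entry h_def block_coeff_def block_vec_def of_nat_diff algebra_simps)
qed

text \<open>The columns of the rank-one matrix are multiples of the eigenvector
  \<open>block_vec\<close> for \<open>4t - 3\<close>.\<close>

lemma block_mat_d_cubic:
  assumes "0 < t"
  shows "block_mat_d t * (int (4 * t) \<cdot>\<^sub>m block_mat_d t - block_mat_d t * block_mat_d t)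
    = (4 * int t - 3) \<cdot>\<^sub>m (int (4 * t) \<cdot>\<^sub>m block_mat_d t - block_mat_d t * block_mat_d t)"
    (is "?B * ?Y = _ \<cdot>\<^sub>m ?Y")
proof (rule eq_matI)
  note c = block_mat_d_carrier[OF assms]
  have Y: "?Y \<in> carrier_mat (4 * t - 1) (4 * t - 1)" using c by auto
  fix i j assume "i < dim_row ((4 * int t - 3) \<cdot>\<^sub>m ?Y)" "j < dim_col ((4 * int t - 3) \<cdot>\<^sub>m ?Y)"
  then have ij: "i < 4 * t - 1" "j < 4 * t - 1" using Y by auto
  define h where "h b = block_coeff (block_d t i) b * (block_vec b * block_vec (block_d t j))" for b
  have "(?B * ?Y) $$ (i, j) = (\<Sum>k<4 * t - 1. h (block_d t k))"
    unfolding mult_mat_entry[OF c Y ij]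
    by (intro sum.cong refl)
      (simp only: h_def lessThan_iff block_mat_d_entry[OF assms ij(1)] block_mat_d_quadratic[OF assms _ ij(2)])
  also have "\<dots> = int (t - 1) * h 0 + int t * (h 1 + h 2 + h 3)"
    by (rule sum_block_d[OF assms])
  also have "\<dots> = (4 * int t - 3) * (block_vec (block_d t i) * block_vec (block_d t j))"
    using assms block_d_less[of t i]
    by (auto simp: h_def block_coeff_def block_vec_def of_nat_diff algebra_simps)
  also have "\<dots> = ((4 * int t - 3) \<cdot>\<^sub>m ?Y) $$ (i, j)"
    unfolding block_mat_d_quadratic[OF assms ij, symmetric] using Y ij by (intro index_smult_mat(1)[symmetric]) auto
  finally show "(?B * ?Y) $$ (i, j) = ((4 * int t - 3) \<cdot>\<^sub>m ?Y) $$ (i, j)" .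
qed (use block_mat_d_carrier[OF assms] in auto)

text \<open>These two numbers later determine the multiplicities of the exceptional
  eigenvalues.\<close>

lemma block_mat_d_traces:
  assumes "0 < t"
  shows "mat_trace (block_mat_d t) = 12 * int t - 3"
    and "mat_trace (int (4 * t) \<cdot>\<^sub>m block_mat_d t - block_mat_d t * block_mat_d t) = 3 * (4 * int t - 3)"
      (is "mat_trace ?Y = _")
proof -
  note c = block_mat_d_carrier[OF assms]
  have Y: "?Y \<in> carrier_mat (4 * t - 1) (4 * t - 1)" using c by auto
  have "mat_trace (block_mat_d t) = (\<Sum>i<4 * t - 1. 3)"
    using c assms unfolding mat_trace_def
    by (intro sum.cong) (auto simp: block_mat_d_entry block_coeff_def)
  then show "mat_trace (block_mat_d t) = 12 * int t - 3" using assms by (simp add: of_nat_diff)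
  have "mat_trace ?Y = (\<Sum>i<4 * t - 1. (block_vec (block_d t i))\<^sup>2)"
    unfolding mat_trace_def using Y block_mat_d_quadratic[OF assms]
    by (intro sum.cong) (auto simp: power2_eq_square simp del: index_minus_mat)
  also have "\<dots> = 3 * (4 * int t - 3)"
    using sum_block_d[OF assms, of "\<lambda>b. (block_vec b)\<^sup>2"] assms
    by (simp add: block_vec_def of_nat_diff algebra_simps)
  finally show "mat_trace ?Y = 3 * (4 * int t - 3)" .
qed

section \<open>The matrix \<open>(4t + 1)I - S\<^sup>2\<close>\<close>

context triangularized
begin

lemma gap_gram:
  assumes "S\<^sup>T = S" "gap t * gap t = c \<cdot>\<^sub>m gap t"
  shows "\<forall>i<n. \<forall>j<n. c * gap t $$ (i, j) = (\<Sum>k<n. gap t $$ (i, k) * gap t $$ (j, k))"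
proof (intro allI impI)
  fix i j assume ij: "i < n" "j < n"
  have "c * gap t $$ (i, j) = (c \<cdot>\<^sub>m gap t) $$ (i, j)"
    using gap_carrier[of t] ij by (intro index_smult_mat(1)[symmetric]) auto
  then show "c * gap t $$ (i, j) = (\<Sum>k<n. gap t $$ (i, k) * gap t $$ (j, k))"
    unfolding assms(2)[symmetric]
    by (simp only: symmetric_square_entry[OF gap_carrier gap_symmetric[OF assms(1)] ij])
qed

lemma symmetric_mult_self: "A \<in> carrier_mat n n \<Longrightarrow> A\<^sup>T = A \<Longrightarrow> (A * A)\<^sup>T = A * (A :: int mat)"
  by (simp add: transpose_mult[of _ n n _ n])

text \<open>On the spectrum of \<open>S\<close> the values of \<open>M\<close> are \<open>0\<close>
  and \<open>c\<close>, and both are roots of \<open>x^2 - c x\<close>.\<close>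

lemma gap_square:
  assumes "S\<^sup>T = S" "\<And>e. e \<in> set es \<Longrightarrow> e * e = 4 * of_nat t + 1 \<or> 4 * of_nat t + 1 - e * e = of_int c"
  shows "gap t * gap t = c \<cdot>\<^sub>m gap t"
proof (rule symmetric_acts_as_eqI[OF acts_as_mult[OF acts_as_gap acts_as_gap] acts_as_smult[OF acts_as_gap]])
  show "(gap t * gap t)\<^sup>T = gap t * gap t"
    by (rule symmetric_mult_self[OF gap_carrier gap_symmetric[OF assms(1)]])
  show "(c \<cdot>\<^sub>m gap t)\<^sup>T = c \<cdot>\<^sub>m gap t"
    by (simp add: transpose_scaled gap_symmetric[OF assms(1)])
  show "(4 * of_nat t + 1 - e * e) * (4 * of_nat t + 1 - e * e) = of_int c * (4 * of_nat t + 1 - e * e)"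
    if "e \<in> set es" for e
    using assms(2)[OF that] by (elim disjE) simp_all
qed

lemma gap_square_eigenvalue:
  assumes "gap t * gap t = c \<cdot>\<^sub>m gap t" "e \<in> set es"
  shows "(4 * of_nat t + 1 - e * e) * (4 * of_nat t + 1 - e * e) = of_int c * (4 * of_nat t + 1 - e * e)"
  by (rule acts_as_eq[OF acts_as_mult[OF acts_as_gap acts_as_gap, of t t, unfolded assms(1)]
        acts_as_smult[OF acts_as_gap] assms(2)])

lemma gap_parity:
  assumes "seidel_mat S" "i < n" "j < n" "i \<noteq> j"
  shows "even (gap t $$ (i, j)) \<longleftrightarrow> even n"
  using gap_entry[OF assms(2,3)] seidel_mat_square_parity[OF assms(1) S assms(2-4)] assms(4) by simp

lemma gap_diag: "(S * S) $$ (i, i) = int n - 1 \<Longrightarrow> i < n \<Longrightarrow> gap t $$ (i, i) = 4 * int t + 2 - int n"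
  using gap_entry[of i i t] by simp

lemma gap_zero_iff:
  assumes t: "0 < t" and "seidel_mat S"
  shows "mset es = mset (spec [] (2 * t + 1) t) \<longleftrightarrow> gap t = 0\<^sub>m n n"
proof
  assume *: "mset es = mset (spec [] (2 * t + 1) t)"
  have n: "n = 4 * t + 2" using length_spec[OF *] by simp
  have "S\<^sup>T = S" using spec_symmetric(1)[OF assms(2) *] by (simp add: n algebra_simps)
  then show "gap t = 0\<^sub>m n n"
    using set_spec[OF *] by (intro symmetric_acts_as_zero[OF acts_as_gap] gap_symmetric) auto
next
  assume *: "gap t = 0\<^sub>m n n"
  have eq: "gap t = 0 \<cdot>\<^sub>m 1\<^sub>m n" unfolding * by (intro eq_matI) auto
  have e: "e * e = 4 * of_nat t + 1" if "e \<in> set es" for e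
    using acts_as_eq[OF acts_as_gap[of t, unfolded eq] acts_as_smult[OF acts_as_one] that] by simp
  note cases = seidel_mat_cases[OF assms(2) S]
  \<comment> \<open>The zero matrix here has the unknown order \<open>n\<close>. A positive diagonal
    entry of the square rules out the negative alternative and yields
    \<open>n = 4t + 2\<close>.\<close>
  have "(S * S) $$ (0, 0) = 4 * int t + 1" using gap_entry[of 0 0 t] cases(1) * by simp
  then have n: "n = 4 * t + 2" using cases(1,3) by auto
  show "mset es = mset (spec [] (2 * t + 1) t)"
  proof (rule spec_balanced(1))
    show "mset (filter (\<lambda>e. e * e \<noteq> 4 * of_nat t + 1) es) = mset []"
      using e by (simp add: filter_empty_conv)
  qed (use t n cases in auto)
qed

text \<open>Forward, \<open>M\<close> has eigenvalues \<open>0\<close> and \<open>4t + 1\<close>,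
  unit diagonal and odd entries. Backward, \<open>J\<close> has trace \<open>4t + 1\<close>, so
  \<open>M\<close> has that eigenvalue once and \<open>S\<close> has the eigenvalue \<open>0\<close>
  once.\<close>

lemma gap_all_ones_iff:
  assumes t: "0 < t" and "seidel_mat S"
  shows "mset es = mset (spec [0] (2 * t) t)
    \<longleftrightarrow> switching_equivalent (gap t) (all_ones (4 * t + 1) (4 * t + 1))"
    (is "_ \<longleftrightarrow> switching_equivalent _ ?J")
proof
  assume *: "mset es = mset (spec [0] (2 * t) t)"
  have n: "n = 4 * t + 1" using length_spec[OF *] by simp
  have sym: "S\<^sup>T = S" and diag: "i < n \<Longrightarrow> (S * S) $$ (i, i) = int n - 1" for i
    using spec_symmetric[OF assms(2) *] t by (auto simp: n algebra_simps)
  have sq: "gap t * gap t = (4 * int t + 1) \<cdot>\<^sub>m gap t"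
    using set_spec[OF *] by (intro gap_square sym) auto
  have gdiag: "gap t $$ (i, i) = 1" if "i < n" for i using gap_diag[OF diag[OF that] that] n by simp
  have godd: "odd (gap t $$ (i, j))" if "i < n" "j < n" for i j
    using gap_parity[OF assms(2) that, of t] gdiag[OF that(1)] n by (cases "i = j") auto
  have pos: "0 < 4 * int t + 1" by simp
  obtain \<delta> where \<delta>: "\<And>i. i < n \<Longrightarrow> \<delta> i \<in> {1, -1}"
    "\<And>i j. i < n \<Longrightarrow> j < n \<Longrightarrow> gap t $$ (i, j) = \<delta> i * \<delta> j"
    by (rule rank_one_gram_signs[OF gap_gram[OF sym sq] pos]) (use gdiag godd in blast)+
  show "switching_equivalent (gap t) ?J"
    by (rule switching_equivalent_fibersI[where n = n and f = "\<lambda>_. ()" and g = "\<lambda>_. ()" and \<beta> = "\<lambda>_ _. 1" and \<delta> = \<delta>])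
      (use \<delta> gap_carrier n all_ones_carrier in \<open>auto simp: all_ones_def\<close>)
next
  assume "switching_equivalent (gap t) ?J"
  then obtain P' Q' where w: "similar_mat_wit (gap t) ?J Q' P'" by (auto simp: switching_equivalent_def)
  note g = gap_carrier[of t]
  have n: "n = 4 * t + 1" using similar_mat_witD2(5)[OF g w] by (auto simp: all_ones_def)
  have sq: "gap t * gap t = int (4 * t + 1) \<cdot>\<^sub>m gap t"
    using similar_mat_wit_unique[OF similar_mat_wit_mult[OF g g w w]] similar_mat_wit_scaled[OF g w]
    unfolding all_ones_square .
  have tr: "mat_trace (gap t) = int (4 * t + 1)"
    unfolding similar_mat_wit_trace[OF w] by (simp add: mat_trace_def all_ones_def)
  have eq: "(4 * of_nat t + 1 - e * e) * (4 * of_nat t + 1 - e * e) = (1 + 4 * of_nat t) * (4 * of_nat t + 1 - e * e)"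
    if "e \<in> set es" for e
    using gap_square_eigenvalue[OF sq that] by simp
  \<comment> \<open>Selects the exceptional eigenvalues, those on which \<open>M\<close> does not
    vanish.\<close>
  let ?R = "\<lambda>e. e * e \<noteq> 4 * of_nat t + 1"
  have e0: "e = 0" if "e \<in> set es" "?R e" for e
    using eq[OF that(1)] that(2) by auto
  have "of_int (int (4 * t + 1)) = (\<Sum>e\<leftarrow>es. 4 * of_nat t + 1 - e * e)"
    using mat_trace_acts_as[OF acts_as_gap, of t] unfolding tr .
  also have "\<dots> = of_nat (length (filter ?R es)) * (4 * of_nat t + 1)"
    using e0 by (intro sum_list_indicator) auto
  finally have "of_nat (1 * (4 * t + 1)) = (of_nat (length (filter ?R es) * (4 * t + 1)) :: complex)"
    by (simp add: algebra_simps)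
  then have "length (filter ?R es) = 1" by (simp only: of_nat_eq_iff mult_cancel2) simp
  then obtain z where z: "filter ?R es = [z]" by (auto simp: length_Suc_conv)
  then have "z \<in> set (filter ?R es)" by simp
  then have "z = 0" using e0 by simp
  show "mset es = mset (spec [0] (2 * t) t)"
    by (rule spec_balanced(1)[OF t seidel_mat_cases(2)[OF assms(2) S]]) (use z \<open>z = 0\<close> n in auto)
qed

text \<open>The eigenvalues \<open>1\<close> and \<open>-1\<close> both give \<open>4t\<close> for
  \<open>M\<close>. Backward, the trace \<open>8t\<close> leaves two exceptional eigenvalues of
  square 1, and their zero sum makes them opposite.\<close>

lemma gap_block_c_iff:
  assumes t: "0 < t" and "seidel_mat S"
  shows "mset es = mset (spec [1, -1] (2 * t - 1) t) \<longleftrightarrow> switching_equivalent (gap t) (block_mat_c t)"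
proof
  assume *: "mset es = mset (spec [1, -1] (2 * t - 1) t)"
  have n: "n = 4 * t" using length_spec[OF *] t by simp
  have sym: "S\<^sup>T = S" and diag: "i < n \<Longrightarrow> (S * S) $$ (i, i) = int n - 1" for i
    using spec_symmetric[OF assms(2) *] t by (auto simp: n of_nat_diff algebra_simps)
  have sq: "gap t * gap t = int n \<cdot>\<^sub>m gap t"
    using set_spec[OF *] n by (intro gap_square sym) force
  have gdiag: "gap t $$ (i, i) = 2" if "i < n" for i using gap_diag[OF diag[OF that] that] n by simp
  obtain \<delta> :: "nat \<Rightarrow> int" and f where \<delta>: "\<And>i. i < n \<Longrightarrow> \<delta> i \<in> {1, -1}"
    "card {i \<in> {..<n}. f i} = 2 * t"
    "\<And>i j. i < n \<Longrightarrow> j < n \<Longrightarrow> gap t $$ (i, j) = \<delta> i * \<delta> j * (if f i = f j then 2 else 0)"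
  proof (rule rank_two_gram_signs[OF gap_gram[OF sym sq] n t])
    show "gap t $$ (i, j) = gap t $$ (j, i)" if "i < n" "j < n" for i j
      using gap_symmetric[OF sym, of t] gap_carrier[of t] that by (metis carrier_matD index_transpose_mat(1))
    show "even (gap t $$ (i, j))" if "i < n" "j < n" for i j
      using gap_parity[OF assms(2) that, of t] gdiag[OF that(1)] n by (cases "i = j") auto
  qed (use gdiag in blast)+
  show "switching_equivalent (gap t) (block_mat_c t)"
  proof (rule switching_equivalent_fibersI[where n = n and f = f and g = "\<lambda>i. i < 2 * t"
        and \<beta> = "\<lambda>a b. if a = b then 2 else 0" and \<delta> = \<delta>])
    show "card {i \<in> {..<n}. f i = k} = card {i \<in> {..<n}. (i < 2 * t) = k}" for k
    proof -
      have compl: "{i \<in> {..<n}. p i = False} = {..<n} - {i \<in> {..<n}. p i = True}" for p :: "nat \<Rightarrow> bool"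
        by auto
      have "{i \<in> {..<n}. (i < 2 * t) = True} = {..<2 * t}" using n by auto
      then have "card {i \<in> {..<n}. (i < 2 * t) = True} = 2 * t" by simp
      moreover have "card {i \<in> {..<n}. f i = True} = 2 * t" using \<delta>(2) by simp
      ultimately show ?thesis
        by (cases k) (simp_all only: compl, subst (1 2) card_Diff_subset, auto)
    qed
  qed (use \<delta> gap_carrier n block_mat_c_carrier block_mat_c_entry in auto)
next
  assume "switching_equivalent (gap t) (block_mat_c t)"
  then obtain P' Q' where w: "similar_mat_wit (gap t) (block_mat_c t) Q' P'"
    by (auto simp: switching_equivalent_def)
  note g = gap_carrier[of t]
  have n: "n = 4 * t" using similar_mat_witD2(5)[OF g w] block_mat_c_carrier[of t] by auto
  have sq: "gap t * gap t = int (4 * t) \<cdot>\<^sub>m gap t"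
    using similar_mat_wit_unique[OF similar_mat_wit_mult[OF g g w w]] similar_mat_wit_scaled[OF g w]
    unfolding block_mat_c_square .
  have tr: "mat_trace (gap t) = int (8 * t)"
    unfolding similar_mat_wit_trace[OF w] using block_mat_c_carrier[of t]
    by (simp add: mat_trace_def block_mat_c_entry)
  have eq: "(4 * of_nat t + 1 - e * e) * (4 * of_nat t + 1 - e * e) = 4 * of_nat t * (4 * of_nat t + 1 - e * e)"
    if "e \<in> set es" for e
    using gap_square_eigenvalue[OF sq that] by simp
  let ?R = "\<lambda>e. e * e \<noteq> 4 * of_nat t + 1"
  have e1: "e * e = 1" if "e \<in> set es" "?R e" for e
    using eq[OF that(1)] that(2) by auto
  have "8 * of_nat t = (\<Sum>e\<leftarrow>es. 4 * of_nat t + 1 - e * e)"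
    using mat_trace_acts_as[OF acts_as_gap, of t] tr by simp
  also have "\<dots> = of_nat (length (filter ?R es)) * (4 * of_nat t)"
    using e1 by (intro sum_list_indicator) auto
  finally have "of_nat (2 * (4 * t)) = (of_nat (length (filter ?R es) * (4 * t)) :: complex)" by simp
  then have "length (filter ?R es) = 2" using t by (simp only: of_nat_eq_iff mult_cancel2) simp
  then obtain u v where uv: "filter ?R es = [u, v]" by (auto simp: length_Suc_conv numeral_2_eq_2)
  then have "u \<in> set (filter ?R es)" "v \<in> set (filter ?R es)" by simp_all
  then have "u * u = 1" "v * v = 1" using e1 by simp_all
  then have pm: "u = 1 \<or> u = -1" "v = 1 \<or> v = -1" by (simp_all add: square_eq_1_iff)
  have "norm (sum_list [u, v]) \<le> 4" using pm by auto
  note balanced = spec_balanced[OF t seidel_mat_cases(2)[OF assms(2) S] _ _ this, of "2 * t - 1"]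
  have "u + v = 0" using balanced(2) uv n t by simp
  then have "mset [u, v] = mset [1, -1]" using pm by auto
  then show "mset es = mset (spec [1, -1] (2 * t - 1) t)"
    using balanced(1) uv n t by simp
qed

text \<open>Both spectra give the values \<open>4t - 3\<close>, \<open>4t\<close>, \<open>4t\<close>
  for \<open>M\<close>, so one forward argument over \<open>u\<close>, \<open>v\<close> covers them.
  Backward, the sign pattern is recovered from the zero sum.\<close>

lemma gap_block_d_iff:
  assumes t: "0 < t" and "seidel_mat S"
  shows "mset es = mset (spec [-2, 1, 1] (2 * (t - 1)) t) \<or> mset es = mset (spec [2, -1, -1] (2 * (t - 1)) t)
    \<longleftrightarrow> switching_equivalent (gap t) (block_mat_d t)"
proof -
  let ?Y = "int (4 * t) \<cdot>\<^sub>m gap t - gap t * gap t"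
  let ?f = "\<lambda>e :: complex. 4 * of_nat t + 1 - e * e"
  let ?y = "\<lambda>e :: complex. 4 * of_nat t * ?f e - ?f e * ?f e"
  note g = gap_carrier[of t]
  have Y: "?Y \<in> carrier_mat n n" using g by auto
  have acts_Y: "acts_as ?Y ?y"
    using acts_as_minus[OF acts_as_smult[OF acts_as_gap, of "int (4 * t)"] acts_as_mult[OF acts_as_gap acts_as_gap], of t t]
    by simp
  have forward: "switching_equivalent (gap t) (block_mat_d t)"
    if *: "mset es = mset (spec [u, v, v] (2 * (t - 1)) t)" and uv: "u * u = 4" "v * v = 1" for u v
  proof -
    have n: "n = 4 * t - 1" using length_spec[OF *] t by simp
    then have int_n: "int n = 4 * int t - 1" using t by simp
    have sym: "S\<^sup>T = S" and diag: "i < n \<Longrightarrow> (S * S) $$ (i, i) = int n - 1" for i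
      using spec_symmetric[OF assms(2) *] t uv by (auto simp: n of_nat_diff algebra_simps)
    have Ysym: "?Y\<^sup>T = ?Y"
      using g gap_symmetric[OF sym, of t]
      by (simp add: transpose_minus[of _ n n] symmetric_mult_self transpose_scaled del: int_ops of_nat_mult)
    \<comment> \<open>\<open>?y\<close> is zero where \<open>?f\<close> is \<open>0\<close> or
      \<open>4t\<close>, and equals \<open>3 (4t - 3)\<close> where \<open>?f\<close> is
      \<open>4t - 3\<close>.\<close>
    have YY: "?Y * ?Y = (3 * (4 * int t - 3)) \<cdot>\<^sub>m ?Y"
    proof (rule symmetric_acts_as_eqI[OF acts_as_mult[OF acts_Y acts_Y] acts_as_smult[OF acts_Y]])
      show "(?Y * ?Y)\<^sup>T = ?Y * ?Y" by (rule symmetric_mult_self[OF Y Ysym])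
      show "((3 * (4 * int t - 3)) \<cdot>\<^sub>m ?Y)\<^sup>T = (3 * (4 * int t - 3)) \<cdot>\<^sub>m ?Y" unfolding transpose_scaled Ysym ..
      fix e assume "e \<in> set es"
      then have "e * e = 4 * of_nat t + 1 \<or> e * e = 4 \<or> e * e = 1" using set_spec[OF *] uv by auto
      then have f: "?f e = 0 \<or> ?f e = 4 * of_nat t - 3 \<or> ?f e = 4 * of_nat t" by auto
      show "?y e * ?y e = of_int (3 * (4 * int t - 3)) * ?y e"
        using f by (elim disjE; simp only:; simp add: algebra_simps)
    qed
    have trY: "mat_trace ?Y = 3 * (4 * int t - 3)"
    proof -
      have "of_int (mat_trace ?Y) = (\<Sum>e\<leftarrow>es. ?y e)" by (rule mat_trace_acts_as[OF acts_Y])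
      also have "\<dots> = of_int (3 * (4 * int t - 3))"
        unfolding sum_spec[OF *] by (simp add: uv surd_square; simp add: algebra_simps)
      finally show ?thesis by (simp only: of_int_eq_iff)
    qed
    have gsym: "gap t $$ (i, j) = gap t $$ (j, i)" if "i < n" "j < n" for i j
      using gap_symmetric[OF sym, of t] g that by (metis carrier_matD index_transpose_mat(1))
    have gdiag: "gap t $$ (i, i) = 3" if "i < n" for i using gap_diag[OF diag[OF that] that] int_n by simp
    interpret G: rank_three_gram n t "\<lambda>i j. gap t $$ (i, j)" "\<lambda>i j. ?Y $$ (i, j)"
    proof
      show "odd (gap t $$ (i, j))" if "i < n" "j < n" for i j
        using gap_parity[OF assms(2) that, of t] gdiag[OF that(1)] n t by (cases "i = j") auto
      show "?Y $$ (i, j) = 4 * int t * gap t $$ (i, j) - (\<Sum>k<n. gap t $$ (i, k) * gap t $$ (j, k))"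
        if "i < n" "j < n" for i j
      proof -
        have "?Y $$ (i, j) = 4 * int t * gap t $$ (i, j) - (gap t * gap t) $$ (i, j)"
          using g that by (simp del: index_mult_mat(1))
        then show ?thesis by (simp only: symmetric_square_entry[OF g gap_symmetric[OF sym] that])
      qed
      show "3 * (4 * int t - 3) * ?Y $$ (i, j) = (\<Sum>k<n. ?Y $$ (i, k) * ?Y $$ (j, k))"
        if "i < n" "j < n" for i j
      proof -
        have "((3 * (4 * int t - 3)) \<cdot>\<^sub>m ?Y) $$ (i, j) = 3 * (4 * int t - 3) * ?Y $$ (i, j)"
          using Y that by (intro index_smult_mat(1)) auto
        then show ?thesis unfolding YY[symmetric] by (simp only: symmetric_square_entry[OF Y Ysym that])
      qed
      show "(\<Sum>i<n. ?Y $$ (i, i)) = 3 * (4 * int t - 3)"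
        using trY Y unfolding mat_trace_def by (simp only: carrier_matD)
    qed (use n t gsym gdiag in auto)
    obtain \<delta> :: "nat \<Rightarrow> int" and f :: "nat \<Rightarrow> nat" where \<delta>: "\<And>i. i < n \<Longrightarrow> \<delta> i \<in> {1, -1}"
      "\<And>k. card {i \<in> {..<n}. f i = k} = (if k = 0 then t - 1 else if k \<le> 3 then t else 0)"
      "\<And>i j. i < n \<Longrightarrow> j < n \<Longrightarrow> gap t $$ (i, j) = \<delta> i * \<delta> j * block_coeff (f i) (f j)"
      using G.signs by blast
    show ?thesis
    proof (rule switching_equivalent_fibersI[where n = n and f = f and g = "block_d t"
          and \<beta> = block_coeff and \<delta> = \<delta>])
      show "card {i \<in> {..<n}. f i = k} = card {i \<in> {..<n}. block_d t i = k}" for k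
        using \<delta>(2)[of k] card_block_d[OF t, of k] unfolding n by simp
      show "block_mat_d t $$ (i, j) = block_coeff (block_d t i) (block_d t j)" if "i < n" "j < n" for i j
        using block_mat_d_entry[OF t] that n by simp
    qed (use \<delta> g n block_mat_d_carrier[OF t] in auto)
  qed
  have backward: "mset es = mset (spec [-2, 1, 1] (2 * (t - 1)) t) \<or> mset es = mset (spec [2, -1, -1] (2 * (t - 1)) t)"
    if equivalent: "switching_equivalent (gap t) (block_mat_d t)"
  proof -
    let ?B = "block_mat_d t"
    let ?YB = "int (4 * t) \<cdot>\<^sub>m ?B - ?B * ?B"
    obtain P' Q' where w: "similar_mat_wit (gap t) ?B Q' P'"
      using equivalent by (auto simp: switching_equivalent_def)
    have n: "n = 4 * t - 1" using similar_mat_witD2(5)[OF g w] block_mat_d_carrier[OF t] by auto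
    have c: "int (4 * t) \<cdot>\<^sub>m gap t \<in> carrier_mat n n" "gap t * gap t \<in> carrier_mat n n" using g by auto
    have wY: "similar_mat_wit ?Y ?YB Q' P'"
      by (rule similar_mat_wit_minus[OF c similar_mat_wit_scaled[OF g w] similar_mat_wit_mult[OF g g w w]])
    have cubic: "gap t * ?Y = (4 * int t - 3) \<cdot>\<^sub>m ?Y"
      using similar_mat_wit_unique[OF similar_mat_wit_mult[OF g Y w wY]] similar_mat_wit_scaled[OF Y wY]
      unfolding block_mat_d_cubic[OF t] .
    have tr: "mat_trace (gap t) = 12 * int t - 3" "mat_trace ?Y = 3 * (4 * int t - 3)"
      unfolding similar_mat_wit_trace[OF w] similar_mat_wit_trace[OF wY] by (rule block_mat_d_traces[OF t])+
    have eq: "?f e * ?y e = (4 * of_nat t - 3) * ?y e" if "e \<in> set es" for e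
      using acts_as_eq[OF acts_as_mult[OF acts_as_gap[of t] acts_Y, unfolded cubic] acts_as_smult[OF acts_Y] that]
      by simp
    have vals: "e * e = 4 * of_nat t + 1 \<or> e * e = 1 \<or> e * e = 4" if "e \<in> set es" for e
    proof -
      have "?f e * (4 * of_nat t - ?f e) * (?f e - (4 * of_nat t - 3)) = 0"
        using eq[OF that] by (simp add: algebra_simps)
      then show ?thesis by auto
    qed
    \<comment> \<open>Keeps the possible squares \<open>4t + 1\<close>, \<open>4\<close>,
      \<open>1\<close> apart, so that the filters below count disjoint families.\<close>
    have t4: "(4 :: complex) * of_nat t + 1 \<noteq> 4" "(4 :: complex) * of_nat t + 1 \<noteq> 1"
      "(4 :: complex) * of_nat t - 3 \<noteq> 0"
    proof -
      have "of_nat (4 * t + 1) \<noteq> (of_nat 4 :: complex)" "of_nat (4 * t) \<noteq> (of_nat 3 :: complex)"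
        unfolding of_nat_eq_iff by presburger+
      then show "(4 :: complex) * of_nat t + 1 \<noteq> 4" "(4 :: complex) * of_nat t + 1 \<noteq> 1"
        "(4 :: complex) * of_nat t - 3 \<noteq> 0" using t by auto
    qed
    define p q where "p = length (filter (\<lambda>e. e * e = 1) es)" and "q = length (filter (\<lambda>e. e * e = 4) es)"
    have "of_int (3 * (4 * int t - 3)) = (\<Sum>e\<leftarrow>es. ?y e)"
      using mat_trace_acts_as[OF acts_Y] unfolding tr .
    also have "\<dots> = of_nat q * (3 * (4 * of_nat t - 3))"
      unfolding q_def
    proof (rule sum_list_indicator)
      show "?y e = (if e * e = 4 then 3 * (4 * of_nat t - 3) else 0)" if "e \<in> set es" for e
        using vals[OF that]
      proof (elim disjE)
        assume e: "e * e = 4"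
        show ?thesis unfolding e by (simp add: algebra_simps)
      qed (use t4 in simp_all)
    qed
    finally have "q = 1" using t4 by simp
    \<comment> \<open>The trace of \<open>?Y\<close> has counted the eigenvalues of square 4.
      Removing their share \<open>4t - 3\<close> from the trace of \<open>M\<close> leaves
      \<open>8t\<close>, which is \<open>4t\<close> for each eigenvalue of square 1.\<close>
    have "of_int (12 * int t - 3) = (\<Sum>e\<leftarrow>es. ?f e)"
      using mat_trace_acts_as[OF acts_as_gap, of t] unfolding tr .
    also have "\<dots> = (\<Sum>e\<leftarrow>es. (if e * e = 1 then 4 * of_nat t else 0) + (if e * e = 4 then 4 * of_nat t - 3 else 0))"
      using vals t4 by (intro arg_cong[where f = sum_list] map_cong) force+
    also have "\<dots> = of_nat p * (4 * of_nat t) + of_nat q * (4 * of_nat t - 3)"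
      unfolding sum_list_addf p_def q_def
      by (intro arg_cong2[where f = "(+)"] sum_list_indicator) auto
    finally have "of_nat (2 * (4 * t)) = (of_nat (p * (4 * t)) :: complex)" using \<open>q = 1\<close> by (simp add: algebra_simps)
    then have "p = 2" using t by (simp only: of_nat_eq_iff mult_cancel2) simp
    obtain u where u: "filter (\<lambda>e. e * e = 4) es = [u]" using \<open>q = 1\<close> by (auto simp: q_def length_Suc_conv)
    obtain v w' where vw: "filter (\<lambda>e. e * e = 1) es = [v, w']"
      using \<open>p = 2\<close> by (auto simp: p_def length_Suc_conv numeral_2_eq_2)
    have "u \<in> set (filter (\<lambda>e. e * e = 4) es)" "v \<in> set (filter (\<lambda>e. e * e = 1) es)"
      "w' \<in> set (filter (\<lambda>e. e * e = 1) es)" unfolding u vw by simp_all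
    then have "u * u = 2 * 2" "v * v = 1" "w' * w' = 1" by simp_all
    then have pm: "u = 2 \<or> u = -2" "v = 1 \<or> v = -1" "w' = 1 \<or> w' = -1"
      unfolding square_eq_iff by (simp_all add: square_eq_1_iff)
    have "filter (\<lambda>e. e * e \<noteq> 4 * of_nat t + 1) es = filter (\<lambda>e. e * e = 4 \<or> e * e = 1) es"
      by (intro filter_cong refl) (metis vals t4(1,2))
    also have "mset \<dots> = mset (filter (\<lambda>e. e * e = 4) es) + mset (filter (\<lambda>e. e * e = 1) es)"
      by (induction es) auto
    also have "\<dots> = mset [u, v, w']" unfolding u vw by simp
    finally have F: "mset (filter (\<lambda>e. e * e \<noteq> 4 * of_nat t + 1) es) = mset [u, v, w']" .
    \<comment> \<open>Equal signs attain \<open>2 + 1 + 1\<close>, the extreme case for the bound in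
      \<open>spec_balanced\<close>.\<close>
    have "norm (sum_list [u, v, w']) \<le> 4" using pm by auto
    moreover have "n = length [u, v, w'] + 2 * (2 * (t - 1))" using n t by simp
    ultimately have balanced: "mset es = mset (spec [u, v, w'] (2 * (t - 1)) t)" "sum_list [u, v, w'] = 0"
      using spec_balanced[OF t seidel_mat_cases(2)[OF assms(2) S] F] by blast+
    have "u + v + w' = 0" using balanced(2) by (simp add: add.assoc)
    then have "(u = 2 \<and> v = -1 \<and> w' = -1) \<or> (u = -2 \<and> v = 1 \<and> w' = 1)" using pm by auto
    then show ?thesis using balanced(1) by auto
  qed
  show ?thesis using forward[of "-2" 1] forward[of 2 "-1"] backward by auto
qed

end

theorem theorem4p5:
  fixes S :: "int mat" and n t :: nat and x :: "int poly"
  defines "x \<equiv> [:0, 1:]"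
  assumes "0 < t" and "seidel_mat S" and "S \<in> carrier_mat n n"
  shows
    "(char_poly S = (x ^ 2 - 4 * of_nat t - 1) ^ (2 * t + 1)
        \<longleftrightarrow> int (4 * t + 1) \<cdot>\<^sub>m 1\<^sub>m n - S * S = 0\<^sub>m n n) \<and>
     (char_poly S = x * (x ^ 2 - 4 * of_nat t - 1) ^ (2 * t)
        \<longleftrightarrow> switching_equivalent (int (4 * t + 1) \<cdot>\<^sub>m 1\<^sub>m n - S * S)
                                 (all_ones (4 * t + 1) (4 * t + 1))) \<and>
     (char_poly S = (x ^ 2 - 1) * (x ^ 2 - 4 * of_nat t - 1) ^ (2 * t - 1)
        \<longleftrightarrow> switching_equivalent (int (4 * t + 1) \<cdot>\<^sub>m 1\<^sub>m n - S * S) (block_mat_c t)) \<and>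
     (char_poly S = (x + 2) * (x - 1) ^ 2 * (x ^ 2 - 4 * of_nat t - 1) ^ (2 * (t - 1)) \<or>
      char_poly S = (x - 2) * (x + 1) ^ 2 * (x ^ 2 - 4 * of_nat t - 1) ^ (2 * (t - 1))
        \<longleftrightarrow> switching_equivalent (int (4 * t + 1) \<cdot>\<^sub>m 1\<^sub>m n - S * S) (block_mat_d t))"
proof -
  note seidel = \<open>seidel_mat S\<close> and pos = \<open>0 < t\<close>
  obtain P Q es where "triangularized n S P Q es"
    using triangularized_exists[OF \<open>S \<in> carrier_mat n n\<close>] by blast
  then interpret triangularized n S P Q es .
  have x: "map_poly of_int x = [:0, 1:]" by (simp add: x_def)
  \<comment> \<open>Case (a) is the instance \<open>g = 1\<close> with no exceptional
    eigenvalues.\<close>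
  have iff: "char_poly S = g * (x ^ 2 - 4 * of_nat t - 1) ^ k \<longleftrightarrow> mset es = mset (spec F k t)"
    if "map_poly of_int g = (\<Prod>e\<leftarrow>F. [:- e, 1:])" for g F k
    using that unfolding x_def
    by (intro char_poly_eq_iff) (simp add: of_int_poly_hom.hom_mult quadratic_hom del: mult_pCons_left mult_pCons_right)
  have b: "map_poly of_int x = (\<Prod>e\<leftarrow>[0]. [:- e, 1:])"
    and c: "map_poly of_int (x ^ 2 - 1) = (\<Prod>e\<leftarrow>[1, -1]. [:- e, 1:])"
    and d: "map_poly of_int ((x + 2) * (x - 1) ^ 2) = (\<Prod>e\<leftarrow>[-2, 1, 1]. [:- e, 1:])"
      "map_poly of_int ((x - 2) * (x + 1) ^ 2) = (\<Prod>e\<leftarrow>[2, -1, -1]. [:- e, 1:])"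
    by (simp_all add: x_def power2_eq_square numeral_poly one_pCons)
  show ?thesis
    using iff[of 1 "[]" "2 * t + 1"] gap_zero_iff[OF pos seidel] iff[OF b, of "2 * t"] gap_all_ones_iff[OF pos seidel]
      iff[OF c, of "2 * t - 1"] gap_block_c_iff[OF pos seidel] iff[OF d(1), of "2 * (t - 1)"]
      iff[OF d(2), of "2 * (t - 1)"] gap_block_d_iff[OF pos seidel]
    unfolding gap_def by simp
qed

end
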